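(* Let $\{\phi_t\}_{t\geq 0}$ be a continuous semigroup of conformal self-maps of the unit disk $\mathbb{D}$. Then, for every $t\ge 0$ and every $p\in\left(-2,\frac{2}{3}\right)$, $$\int_{\mathbb{D}}\left|\phi_t'(w)\right|^p\,dA(w)<\infty.$$
   Context: $\mathbb{D}=\{z\in\mathbb{C}:|z|<1\}$ is the open unit disk and $dA=\frac{dx\,dy}{\pi}$ is the normalized Lebesgue area measure on $\mathbb{D}$. A conformal self-map of $\mathbb{D}$ is an injective holomorphic function $\phi:\mathbb{D}\to\mathbb{D}$ (not necessarily surjective). A continuous semigroup of conformal self-maps of $\mathbb{D}$ is a family $\{\phi_t\}_{t\ge 0}$ of conformal self-maps of $\mathbb{D}$ such that: (i) $\phi_0(z)=z$ for all $z\in\mathbb{D}$; (ii) $\phi_{t+s}(z)=\phi_t(\phi_s(z))$ for all $z\in\mathbb{D}$ and $s,t\ge 0$; (iii) for every $z\in\mathbb{D}$ the map $t\mapsto\phi_t(z)$ is continuous on $[0,\infty)$. *)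

theory Defs
  imports "HOL-Complex_Analysis.Complex_Analysis"
begin

abbreviation unit_disk :: "complex set" ("\<bbbD>") where
  "\<bbbD> \<equiv> ball 0 1"

definition disk_area :: "complex measure" where
  "disk_area = scale_measure (ennreal (1 / pi)) (restrict_space lborel \<bbbD>)"

text \<open>Self-maps are total functions on the complex plane of which only the values on the disk matter;
  they need not be surjective onto the disk.\<close>

definition conformal_self_map :: "(complex \<Rightarrow> complex) \<Rightarrow> bool" where
  "conformal_self_map f \<longleftrightarrow> f holomorphic_on \<bbbD> \<and> inj_on f \<bbbD> \<and> f ` \<bbbD> \<subseteq> \<bbbD>"

text \<open>The family is indexed by all reals, but only the members with nonnegative index are constrained.\<close>

definition continuous_conformal_semigroup :: "(real \<Rightarrow> complex \<Rightarrow> complex) \<Rightarrow> bool" where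
  "continuous_conformal_semigroup \<phi> \<longleftrightarrow>
     (\<forall>t\<ge>0. conformal_self_map (\<phi> t)) \<and>
     (\<forall>z\<in>\<bbbD>. \<phi> 0 z = z) \<and>
     (\<forall>z\<in>\<bbbD>. \<forall>s\<ge>0. \<forall>t\<ge>0. \<phi> (t + s) z = \<phi> t (\<phi> s z)) \<and>
     (\<forall>z\<in>\<bbbD>. continuous_on {0..} (\<lambda>t. \<phi> t z))"

end

theory Submission
  imports Defs
begin

text \<open>
  For \<open>p \<ge> 0\<close> the statement is easy: a self-map of the disk has
  \<open>\<bar>f'(z)\<bar> \<le> 2 / (1 - \<bar>z\<bar>)\<close>, and \<open>1 - \<bar>z\<bar>\<close> to a power above \<open>-1\<close> is integrable over the
  disk. For negative exponents a lower bound on the derivative is needed, and here the semigroup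
  enters. The key estimate is that there are a holomorphic \<open>P\<close> with \<open>Re P \<ge> 0\<close> and a constant
  \<open>C\<close> such that
  \<open>1 - \<bar>z\<bar> \<le> C \<bar>P z\<bar> \<bar>\<phi>\<^sub>t'(z)\<bar>\<^sup>2\<close> on the disk (\<open>semigroup_inverse_derivative_majorant\<close>).
  With \<open>s = -p/2 < 1\<close> it gives \<open>\<bar>\<phi>\<^sub>t'\<bar>\<^sup>p \<le> C' \<bar>P\<bar>\<^sup>s (1 - \<bar>z\<bar>)\<^sup>-\<^sup>s\<close>. Since
  \<open>\<bar>P\<bar>\<^sup>s\<close> is dominated by a multiple of the harmonic function \<open>Re (P\<^sup>s)\<close>, whose integral over an annulus
  is its value at 0 times the area, \<open>P\<close> costs nothing in the integral, and what remains is the convergent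
  integral of \<open>(1 - \<bar>z\<bar>)\<^sup>-\<^sup>s\<close> (\<open>nn_integral_disk_weighted_power\<close>).

  The key estimate comes from the infinitesimal generator \<open>G\<close> of the semigroup, the holomorphic field with
  \<open>d\<phi>\<^sub>s/ds = G(\<phi>\<^sub>s)\<close>, for which \<open>\<phi>\<^sub>t'(z) = G(\<phi>\<^sub>t z) / G z\<close>. A Wolff point \<open>\<tau>\<close> common to all \<open>\<phi>\<^sub>t\<close> lies
  inside the disk or on its boundary, and \<open>G\<close> is an explicit factor vanishing at \<open>\<tau>\<close> times a function
  \<open>P\<close> with \<open>Re P \<ge> 0\<close>. Suppose first \<open>\<tau> = 0\<close>, so that \<open>G z = - z P z\<close>. Two lower bounds for
  \<open>\<bar>P(\<phi>\<^sub>t z)\<bar>\<close> are available.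
  First, the Schwarz-Pick bound for \<open>P'\<close> shows that \<open>\<bar>P(\<phi>\<^sub>s z)\<bar> ln (1/\<bar>\<phi>\<^sub>s z\<bar>)\<close> increases with \<open>s\<close>, so
  \<open>\<bar>P(\<phi>\<^sub>t z)\<bar> / \<bar>P z\<bar>\<close> is at least about \<open>(1 - \<bar>z\<bar>) / (1 - \<bar>\<phi>\<^sub>t z\<bar>)\<close>. Second, Harnack's
  inequality gives \<open>\<bar>P(\<phi>\<^sub>t z)\<bar> \<ge> c (1 - \<bar>\<phi>\<^sub>t z\<bar>)\<close>. In the product of the two bounds
  the factor \<open>1 - \<bar>\<phi>\<^sub>t z\<bar>\<close> cancels, which is exactly the key estimate. An interior \<open>\<tau>\<close> is moved to 0 by a
  Moebius transformation.

  If \<open>\<tau>\<close> is on the circle, the flow is transported to the right half-plane with \<open>\<tau>\<close> at infinity, where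
  it becomes \<open>u' = H(u)\<close> with \<open>Re H \<ge> 0\<close>, and the same product of two bounds works with \<open>Re u\<close> in the role
  of the logarithm. The passage back to the disk costs powers of \<open>\<bar>1 + u(t)\<bar> / \<bar>1 + u(0)\<bar>\<close>, and the
  point is that this ratio is bounded uniformly over all orbits (\<open>half_plane_orbit_growth\<close>).
\<close>

section \<open>Weighted area integrals of functions with nonnegative real part\<close>

lemma distr_lborel_Complex:
  "distr (lborel :: (real \<times> real) measure) borel (\<lambda>(x, y). Complex x y) = lborel"
proof (rule sym, rule lborel_eqI)
  have [measurable]: "(\<lambda>(x, y). Complex x y) \<in> borel_measurable (borel :: (real \<times> real) measure)"
    unfolding case_prod_beta Complex_eq by (intro borel_measurable_continuous_onI continuous_intros)
  fix l u :: complex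
  assume le: "\<And>b. b \<in> Basis \<Longrightarrow> l \<bullet> b \<le> u \<bullet> b"
  have le': "Re l \<le> Re u" "Im l \<le> Im u"
    using le[of 1] le[of \<i>] by (auto simp: Basis_complex_def)
  have eq: "(\<lambda>(x, y). Complex x y) -` box l u = box (Re l, Im l) (Re u, Im u)"
    by (auto simp: box_def Basis_complex_def Basis_prod_def)
  have "emeasure (distr lborel borel (\<lambda>(x, y). Complex x y)) (box l u) =
        emeasure lborel (box (Re l, Im l) (Re u, Im u))"
    by (subst emeasure_distr) (auto simp: eq)
  also have "\<dots> = ennreal (\<Prod>b\<in>Basis. (u - l) \<bullet> b)"
    using le' by (subst emeasure_lborel_box)
      (auto simp: Basis_complex_def Basis_prod_def prod.union_disjoint image_Un)
  finally show "emeasure (distr lborel borel (\<lambda>(x, y). Complex x y)) (box l u) =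
      ennreal (\<Prod>b\<in>Basis. (u - l) \<bullet> b)" .
qed auto

lemma measurable_Complex [measurable]:
  "(\<lambda>z. Complex (fst z) (snd z)) \<in> borel_measurable (borel :: (real \<times> real) measure)"
  unfolding Complex_eq by (intro borel_measurable_continuous_onI continuous_intros)

lemma nn_integral_complex_iterated:
  fixes f :: "complex \<Rightarrow> ennreal"
  assumes [measurable]: "f \<in> borel_measurable borel"
  shows "(\<integral>\<^sup>+z. f z \<partial>lborel) = (\<integral>\<^sup>+y. \<integral>\<^sup>+x. f (Complex x y) \<partial>lborel \<partial>lborel)"
    and "(\<integral>\<^sup>+z. f z \<partial>lborel) = (\<integral>\<^sup>+x. \<integral>\<^sup>+y. f (Complex x y) \<partial>lborel \<partial>lborel)"
proof -
  have "(\<integral>\<^sup>+z. f z \<partial>lborel) = (\<integral>\<^sup>+z. f (Complex (fst z) (snd z)) \<partial>(lborel :: (real \<times> real) measure))"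
    by (subst distr_lborel_Complex[symmetric], subst nn_integral_distr) (auto simp: case_prod_beta)
  then have eq: "(\<integral>\<^sup>+z. f z \<partial>lborel) =
     (\<integral>\<^sup>+z. f (Complex (fst z) (snd z)) \<partial>((lborel :: real measure) \<Otimes>\<^sub>M (lborel :: real measure)))"
    by (simp add: lborel_prod)
  have m: "(\<lambda>z. f (Complex (fst z) (snd z))) \<in> borel_measurable ((lborel :: real measure) \<Otimes>\<^sub>M (lborel :: real measure))"
    unfolding lborel_prod by measurable
  show "(\<integral>\<^sup>+z. f z \<partial>lborel) = (\<integral>\<^sup>+y. \<integral>\<^sup>+x. f (Complex x y) \<partial>lborel \<partial>lborel)"
    unfolding eq using lborel_pair.nn_integral_snd[of "\<lambda>z. f (Complex (fst z) (snd z))"] m by simp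
  show "(\<integral>\<^sup>+z. f z \<partial>lborel) = (\<integral>\<^sup>+x. \<integral>\<^sup>+y. f (Complex x y) \<partial>lborel \<partial>lborel)"
    unfolding eq using lborel.nn_integral_fst[of "\<lambda>z. f (Complex (fst z) (snd z))"] m by simp
qed

lemma nn_integral_shear_Re:
  fixes f :: "complex \<Rightarrow> ennreal"
  assumes [measurable]: "f \<in> borel_measurable borel"
  shows "(\<integral>\<^sup>+z. f (z + of_real (a * Im z)) \<partial>lborel) = (\<integral>\<^sup>+z. f z \<partial>lborel)"
proof -
  have [measurable]: "(\<lambda>x. f (Complex x y)) \<in> borel_measurable borel" for y
    unfolding Complex_eq by measurable
  have [measurable]: "Im \<in> borel_measurable borel"
    by (intro borel_measurable_continuous_onI continuous_intros)
  have "(\<integral>\<^sup>+x. f (Complex x y + of_real (a * y)) \<partial>lborel) = (\<integral>\<^sup>+x. f (Complex x y) \<partial>lborel)" for y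
    by (subst (2) nn_integral_real_affine[where c = 1 and t = "a * y"])
       (auto simp: Complex_eq algebra_simps)
  then show ?thesis
    by (simp add: nn_integral_complex_iterated(1))
qed

lemma nn_integral_shear_Im:
  fixes f :: "complex \<Rightarrow> ennreal"
  assumes [measurable]: "f \<in> borel_measurable borel"
  shows "(\<integral>\<^sup>+z. f (z + \<i> * of_real (b * Re z)) \<partial>lborel) = (\<integral>\<^sup>+z. f z \<partial>lborel)"
proof -
  have [measurable]: "(\<lambda>y. f (Complex x y)) \<in> borel_measurable borel" for x
    unfolding Complex_eq by measurable
  have [measurable]: "Re \<in> borel_measurable borel"
    by (intro borel_measurable_continuous_onI continuous_intros)
  have "(\<integral>\<^sup>+y. f (Complex x y + \<i> * of_real (b * x)) \<partial>lborel) = (\<integral>\<^sup>+y. f (Complex x y) \<partial>lborel)" for x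
    by (subst (2) nn_integral_real_affine[where c = 1 and t = "b * x"])
       (auto simp: Complex_eq algebra_simps)
  then show ?thesis
    by (simp add: nn_integral_complex_iterated(2))
qed

text \<open>
  A rotation is a product of three shears, and each shear preserves the area integral by translation
  invariance on horizontal or vertical lines. The factorization divides by \<open>Im c\<close>, which excludes
  the rotations by 0 and by a half turn.
\<close>

lemma nn_integral_rotate:
  fixes f :: "complex \<Rightarrow> ennreal"
  assumes [measurable]: "f \<in> borel_measurable borel" and c: "cmod c = 1" "Im c \<noteq> 0"
  shows "(\<integral>\<^sup>+z. f (c * z) \<partial>lborel) = (\<integral>\<^sup>+z. f z \<partial>lborel)"
proof -
  define k where "k = - ((1 - Re c) / Im c)"
  have m[measurable]: "Re \<in> borel_measurable borel" "Im \<in> borel_measurable borel"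
    by (intro borel_measurable_continuous_onI continuous_intros)+
  define S where "S = (\<lambda>z. z + of_real (k * Im z) :: complex)"
  define T where "T = (\<lambda>z. z + \<i> * of_real (Im c * Re z) :: complex)"
  have [measurable]: "S \<in> borel_measurable borel" "T \<in> borel_measurable borel"
    unfolding S_def T_def by measurable
  have c2: "(Re c)\<^sup>2 + (Im c)\<^sup>2 = 1"
    using c(1) by (simp add: cmod_def)
  have kk: "1 + k * Im c = Re c" "k * (1 + Re c) = - Im c"
    using c(2) c2 by (auto simp: k_def field_simps power2_eq_square)
  have ST: "S (T (S z)) = c * z" for z
  proof (rule complex_eqI)
    have "Im (S (T (S z))) = (1 + k * Im c) * Im z + Im c * Re z"
      by (simp add: S_def T_def algebra_simps)
    then show "Im (S (T (S z))) = Im (c * z)"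
      by (simp add: kk)
    have "Re (S (T (S z))) = (1 + k * Im c) * Re z + (k * (1 + (1 + k * Im c))) * Im z"
      by (simp add: S_def T_def algebra_simps)
    then show "Re (S (T (S z))) = Re (c * z)"
      by (simp add: kk)
  qed
  have "(\<integral>\<^sup>+z. f (c * z) \<partial>lborel) = (\<integral>\<^sup>+z. f (S (T (S z))) \<partial>lborel)"
    by (simp add: ST)
  also have "\<dots> = (\<integral>\<^sup>+z. f (S (T z)) \<partial>lborel)"
    using nn_integral_shear_Re[of "\<lambda>z. f (S (T z))" k] by (simp add: S_def)
  also have "\<dots> = (\<integral>\<^sup>+z. f (S z) \<partial>lborel)"
    using nn_integral_shear_Im[of "\<lambda>z. f (S z)" "Im c"] by (simp add: T_def)
  also have "\<dots> = (\<integral>\<^sup>+z. f z \<partial>lborel)"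
    using nn_integral_shear_Re[of f k] by (simp add: S_def)
  finally show ?thesis .
qed

lemma distr_lborel_rotate:
  assumes c: "cmod c = 1" "Im c \<noteq> 0"
  shows "distr lborel borel ((*) c) = (lborel :: complex measure)"
proof (rule measure_eqI)
  fix A assume "A \<in> sets (distr lborel borel ((*) c))"
  then have A[measurable]: "A \<in> sets borel" by simp
  have "emeasure (distr lborel borel ((*) c)) A = (\<integral>\<^sup>+z. indicator A z \<partial>distr lborel borel ((*) c))"
    by simp
  also have "\<dots> = (\<integral>\<^sup>+z. indicator A (c * z) \<partial>lborel)"
    by (subst nn_integral_distr) auto
  also have "\<dots> = (\<integral>\<^sup>+z. indicator A z \<partial>lborel)"
    using nn_integral_rotate[OF _ c, of "indicator A"] by simp
  finally show "emeasure (distr lborel borel ((*) c)) A = emeasure lborel A"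
    by simp
qed simp

text \<open>
  Rotating the annulus by \<open>\<pi> / (2m)\<close> multiplies the integrand by \<open>\<i>\<close> and leaves the integral unchanged.
\<close>

lemma annulus_power_integral_zero:
  assumes "m > 0"
  shows "(LINT z:{z. a \<le> cmod z \<and> cmod z < b}|lborel. z ^ m) = (0 :: complex)"
proof -
  define S where "S = {z. a \<le> cmod z \<and> cmod z < b}"
  have [measurable]: "S \<in> sets borel" unfolding S_def by measurable
  (* With this angle c ^ m = \<i>; for m = 1 a half turn, c = -1, would have Im c = 0. *)
  define c where "c = cis (pi / (2 * real m))"
  have c1: "cmod c = 1" by (simp add: c_def)
  have "0 < pi / (2 * real m)" "pi / (2 * real m) < pi"
    using assms by (auto simp: field_simps)
  then have c2: "Im c \<noteq> 0"
    unfolding c_def using sin_gt_zero by force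
  have cm: "c ^ m = \<i>"
  proof -
    have "c ^ m = cis (real m * (pi / (2 * real m)))"
      by (simp only: c_def Complex.DeMoivre)
    then show ?thesis using assms by simp
  qed
  have "(LINT z:S|lborel. z ^ m) = (LINT z|distr lborel borel ((*) c). indicator S z *\<^sub>R z ^ m)"
    unfolding set_lebesgue_integral_def by (simp add: distr_lborel_rotate c1 c2)
  also have "\<dots> = (LINT z|lborel. indicator S (c * z) *\<^sub>R (c * z) ^ m)"
    by (subst integral_distr) auto
  also have "\<dots> = (LINT z|lborel. \<i> * (indicator S z *\<^sub>R z ^ m))"
    by (intro Bochner_Integration.integral_cong)
       (auto simp: indicator_def S_def norm_mult c1 power_mult_distrib cm)
  also have "\<dots> = \<i> * (LINT z:S|lborel. z ^ m)"
    unfolding set_lebesgue_integral_def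
    by (subst integral_mult_right_zero[symmetric]) (simp add: mult_scaleR_right)
  finally have "(1 - \<i>) * (LINT z:S|lborel. z ^ m) = 0"
    by (simp add: algebra_simps)
  moreover have "1 - \<i> \<noteq> 0" by (simp add: complex_eq_iff)
  ultimately show ?thesis by (simp add: S_def)
qed

text \<open>
  The area mean value property: integrate the power series term by term, where only the constant term
  survives.
\<close>

lemma annulus_mean_value:
  fixes a b :: real and f :: "complex \<Rightarrow> complex"
  assumes f: "f holomorphic_on ball 0 1" and b: "b < 1"
  defines "S \<equiv> {z. (a::real) \<le> cmod z \<and> cmod z < b}"
  shows "set_integrable lborel S f"
    and "(LINT z:S|lborel. f z) = measure lborel S *\<^sub>R f 0"
proof -
  have S[measurable]: "S \<in> sets borel" unfolding S_def by measurable
  have "S \<subseteq> ball 0 (max b 0)" by (auto simp: S_def)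
  then have "emeasure lborel S \<le> emeasure lborel (ball (0::complex) (max b 0))"
    by (intro emeasure_mono) auto
  then have fin: "emeasure lborel S < \<infinity>"
    using emeasure_lborel_ball_finite[of 0 "max b 0"] by (meson le_less_trans)
  define A where "A n = (deriv ^^ n) f 0 / fact n" for n
  have sums: "(\<lambda>n. A n * z ^ n) sums f z" if "cmod z < 1" for z
    using holomorphic_power_series[OF f, of z] that by (simp add: A_def)
  define r where "r = max b 0"
  have r: "0 \<le> r" "r < 1" using b by (auto simp: r_def)
  obtain r' where r': "r < r'" "r' < 1" using r dense by blast
  have "summable (\<lambda>n. A n * (complex_of_real r') ^ n)"
    using sums[of "of_real r'"] r r' by (auto simp: sums_iff)
  from powser_insidea[OF this, of "of_real r"] r r'
  have abs: "summable (\<lambda>n. cmod (A n) * r ^ n)"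
    by (simp add: norm_mult norm_power)
  define M where "M = (\<Sum>n. cmod (A n) * r ^ n)"
  have SI: "cmod z < 1" "cmod z \<le> r" if "z \<in> S" for z
    using that b by (auto simp: S_def r_def)
  have bound: "cmod (\<Sum>i<n. A i * z ^ i) \<le> M" if "z \<in> S" for z n
  proof -
    have "cmod (\<Sum>i<n. A i * z ^ i) \<le> (\<Sum>i<n. cmod (A i) * r ^ i)"
      using SI[OF that] by (intro sum_norm_le) (auto simp: norm_mult norm_power intro!: mult_left_mono power_mono)
    also have "\<dots> \<le> M"
      unfolding M_def using r by (intro sum_le_suminf abs) auto
    finally show ?thesis .
  qed
  have contf: "continuous_on S f"
    using SI by (intro continuous_on_subset[OF holomorphic_on_imp_continuous_on[OF f]]) auto
  have lim: "(\<lambda>n. indicator S z *\<^sub>R (\<Sum>i<n. A i * z ^ i)) \<longlonglongrightarrow> indicator S z *\<^sub>R f z" for z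
    using sums[of z] SI[of z] by (cases "z \<in> S") (auto simp: sums_def)
  have dom: "integrable lborel (\<lambda>z. indicator S z *\<^sub>R M)"
    using fin by (simp add: integrable_indicator_iff)
  note dc = integral_dominated_convergence[where M = lborel and
     f = "\<lambda>z. indicator S z *\<^sub>R f z" and s = "\<lambda>n z. indicator S z *\<^sub>R (\<Sum>i<n. A i * z ^ i)"
     and w = "\<lambda>z. indicator S z *\<^sub>R M"]
  note di = integrable_dominated_convergence[where M = lborel and
     f = "\<lambda>z. indicator S z *\<^sub>R f z" and s = "\<lambda>n z. indicator S z *\<^sub>R (\<Sum>i<n. A i * z ^ i)"
     and w = "\<lambda>z. indicator S z *\<^sub>R M"]
  have mf: "(\<lambda>z. indicator S z *\<^sub>R f z) \<in> borel_measurable lborel"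
    using borel_measurable_continuous_on_indicator[OF S contf] by simp
  have ms: "(\<lambda>z. indicator S z *\<^sub>R (\<Sum>i<n. A i * z ^ i)) \<in> borel_measurable lborel" for n
    by measurable
  have bd: "AE z in lborel. norm (indicator S z *\<^sub>R (\<Sum>i<n. A i * z ^ i)) \<le> indicator S z *\<^sub>R M" for n
    using bound by (auto simp: indicator_def intro!: AE_I2)
  show "set_integrable lborel S f"
    unfolding set_integrable_def by (rule di) (use mf ms dom lim bd in auto)
  have conv: "(\<lambda>n. LINT z|lborel. indicator S z *\<^sub>R (\<Sum>i<n. A i * z ^ i)) \<longlonglongrightarrow>
      (LINT z|lborel. indicator S z *\<^sub>R f z)"
    by (rule dc) (use mf ms dom lim bd in auto)
  have intp: "integrable lborel (\<lambda>z. indicator S z *\<^sub>R (z ^ m))" for m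
  proof (rule Bochner_Integration.integrable_bound[where f = "\<lambda>z. indicator S z *\<^sub>R (1::real)"])
    show "integrable lborel (\<lambda>z. indicator S z *\<^sub>R (1::real))"
      using fin by (simp add: integrable_indicator_iff del: indicator_simps indicator_def)
    show "AE z in lborel. norm (indicator S z *\<^sub>R (z ^ m)) \<le> norm (indicator S z *\<^sub>R (1::real))"
      using SI(1)[THEN less_imp_le] by (auto simp: norm_power power_le_one intro!: AE_I2 split: split_indicator)
  qed simp
  have "(LINT z|lborel. indicator S z *\<^sub>R (\<Sum>i<n. A i * z ^ i)) = measure lborel S *\<^sub>R f 0" if "n > 0" for n
  proof -
    have "(LINT z|lborel. indicator S z *\<^sub>R (\<Sum>i<n. A i * z ^ i)) =
          (LINT z|lborel. (\<Sum>i<n. A i * (indicator S z *\<^sub>R z ^ i)))"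
      by (simp add: scaleR_sum_right)
    also have "\<dots> = (\<Sum>i<n. A i * (LINT z|lborel. indicator S z *\<^sub>R z ^ i))"
    proof -
      have "integrable lborel (\<lambda>z. A i * (indicator S z *\<^sub>R z ^ i))" for i
        by (rule integrable_mult_right) (rule intp)
      then show ?thesis
        by (subst Bochner_Integration.integral_sum)
           (simp_all only: integral_mult_right_zero)
    qed
    also have "\<dots> = (\<Sum>i\<in>{0}. A i * (LINT z|lborel. indicator S z *\<^sub>R z ^ i))"
    proof (rule sum.mono_neutral_right)
      show "\<forall>i\<in>{..<n} - {0}. A i * (LINT z|lborel. indicator S z *\<^sub>R z ^ i) = 0"
        using annulus_power_integral_zero[of _ a b]
        by (auto simp: set_lebesgue_integral_def S_def)
    qed (use that in auto)
    also have "\<dots> = measure lborel S *\<^sub>R f 0"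
      by (simp add: A_def scaleR_conv_of_real)
    finally show ?thesis .
  qed
  then have "(\<lambda>n. LINT z|lborel. indicator S z *\<^sub>R (\<Sum>i<n. A i * z ^ i)) \<longlonglongrightarrow> measure lborel S *\<^sub>R f 0"
    by (intro tendsto_eventually eventually_mono[OF eventually_gt_at_top[of 0]]) auto
  with conv show "(LINT z:S|lborel. f z) = measure lborel S *\<^sub>R f 0"
    unfolding set_lebesgue_integral_def by (rule LIMSEQ_unique)
qed

text \<open>
  The argument of \<open>z\<close> is less than \<open>\<pi>/2\<close>, so that of \<open>z powr s\<close> stays below \<open>\<pi> s / 2\<close>. For \<open>s < 1\<close>
  the cosine is positive and \<open>\<bar>z\<bar>\<^sup>s\<close> is dominated by a harmonic function of \<open>z\<close>.
\<close>

lemma Re_powr_ge: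
  assumes "Re z > 0" "0 \<le> s" "s \<le> 1"
  shows "cmod z powr s * cos (pi / 2 * s) \<le> Re (z powr of_real s)"
proof -
  have z: "z \<noteq> 0" using assms by auto
  have "\<bar>Im (Ln z)\<bar> < pi / 2"
    using assms z Re_Ln_pos_lt by blast
  then have "\<bar>s * Im (Ln z)\<bar> \<le> pi / 2 * s"
    using assms mult_left_mono[of "\<bar>Im (Ln z)\<bar>" "pi / 2" s] by (simp add: abs_mult mult.commute)
  moreover have "pi / 2 * s \<le> pi"
    using assms mult_left_le[of s "pi / 2"] pi_ge_zero by linarith
  ultimately have "cos (pi / 2 * s) \<le> cos \<bar>s * Im (Ln z)\<bar>"
    by (intro cos_monotone_0_pi_le) auto
  then have "cos (pi / 2 * s) \<le> cos (s * Im (Ln z))" by simp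
  moreover have "Re (z powr of_real s) = cmod z powr s * cos (s * Im (Ln z))"
    using z by (simp add: powr_def Re_exp)
  ultimately show ?thesis by (simp add: mult_left_mono)
qed

lemma measure_annulus_le:
  assumes "0 \<le> a" "a \<le> b" "b \<le> 1"
  shows "measure lborel {z::complex. a \<le> cmod z \<and> cmod z < b} \<le> 2 * pi * (b - a)"
proof -
  have eq: "{z::complex. a \<le> cmod z \<and> cmod z < b} = ball 0 b - ball 0 a"
    by auto
  have "measure lborel (ball (0::complex) b - ball 0 a) =
     measure lborel (ball (0::complex) b) - measure lborel (ball (0::complex) a)"
    using assms by (intro measure_Diff) (auto simp: emeasure_lborel_ball_finite[THEN less_imp_neq, unfolded infinity_ennreal_def])
  also have "\<dots> = pi * b\<^sup>2 - pi * a\<^sup>2"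
    using assms content_ball[of b "0::complex"] content_ball[of a "0::complex"] by (simp add: unit_ball_vol_2)
  also have "\<dots> = pi * (b + a) * (b - a)" by (simp add: algebra_simps power2_eq_square)
  also have "\<dots> \<le> pi * 2 * (b - a)"
    using assms by (intro mult_right_mono mult_left_mono) auto
  finally show ?thesis by (simp add: eq)
qed

lemma disk_dyadic_annulus:
  assumes "cmod z < 1"
  obtains n :: nat where "1 - (1/2) ^ n \<le> cmod z" "cmod z < 1 - (1/2) ^ Suc n"
proof -
  have "\<exists>n. (1/2::real) ^ n < 1 - cmod z"
    using assms by (intro real_arch_pow_inv) auto
  then obtain k where k: "(1/2::real) ^ k < 1 - cmod z" by blast
  moreover have "(1/2::real) ^ Suc k \<le> (1/2) ^ k" by simp
  ultimately have ex: "cmod z < 1 - (1/2) ^ Suc k" by linarith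
  define n where "n = (LEAST n. cmod z < 1 - (1/2) ^ Suc n)"
  have n: "cmod z < 1 - (1/2) ^ Suc n"
    unfolding n_def using ex by (rule LeastI)
  have "1 - (1/2) ^ n \<le> cmod z"
  proof (cases n)
    case (Suc m)
    then have "\<not> (cmod z < 1 - (1/2) ^ Suc m)"
      using not_less_Least[of m "\<lambda>n. cmod z < 1 - (1/2) ^ Suc n"] by (simp add: n_def)
    then show ?thesis using Suc by simp
  qed simp
  with n show ?thesis using that by blast
qed

text \<open>
  On the annulus \<open>2\<^sup>-\<^sup>n\<^sup>-\<^sup>1 < 1 - \<bar>z\<bar> \<le> 2\<^sup>-\<^sup>n\<close> the weight is at most \<open>2\<^sup>s\<^sup>(\<^sup>n\<^sup>+\<^sup>1\<^sup>)\<close>, while the integral of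
  \<open>\<bar>P\<bar>\<^sup>s\<close> is at most a multiple of the area, that is of \<open>2\<^sup>-\<^sup>n\<close>, by the mean value property of
  \<open>Re (P powr s)\<close>. The resulting geometric series converges because \<open>s < 1\<close>.
\<close>

lemma nn_integral_disk_weighted_power_pos:
  assumes P: "P holomorphic_on ball 0 1" and pos: "\<And>z. z \<in> ball 0 1 \<Longrightarrow> Re (P z) > 0"
    and s: "0 \<le> s" "s < 1"
  shows "(\<integral>\<^sup>+z. ennreal (cmod (P z) powr s * (1 - cmod z) powr (-s)) * indicator (ball 0 1) z \<partial>lborel) < \<infinity>"
proof -
  define f where "f z = P z powr of_real s" for z
  have holf: "f holomorphic_on ball 0 1"
    unfolding f_def using pos by (intro holomorphic_intros P) (force simp: complex_nonpos_Reals_iff)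
  define \<kappa> where "\<kappa> = cos (pi / 2 * s)"
  have \<kappa>: "\<kappa> > 0"
    unfolding \<kappa>_def using s by (intro cos_gt_zero_pi) (auto intro: less_le_trans[of _ 0])
  have le_f: "cmod (P z) powr s \<le> Re (f z) / \<kappa>" if "z \<in> ball 0 1" for z
    using Re_powr_ge[OF pos[OF that], of s] s \<kappa> by (simp add: f_def \<kappa>_def field_simps)
  have f0: "Re (f 0) \<ge> 0"
    using le_f[of 0] \<kappa> by (simp add: field_simps) (smt (verit) mult_nonneg_nonneg powr_ge_zero)
  define A where "A n = {z::complex. 1 - (1/2) ^ n \<le> cmod z \<and> cmod z < 1 - (1/2) ^ Suc n}" for n
  have [measurable]: "A n \<in> sets borel" for n unfolding A_def by measurable
  define w where "w n = (2 powr s) ^ Suc n / \<kappa>" for n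
  have w: "w n \<ge> 0" for n unfolding w_def using \<kappa> by simp
  define C where "C = 2 * pi * Re (f 0) / \<kappa>"
  have AD: "z \<in> ball 0 1" if "z \<in> A n" for z n
    using that zero_less_power[of "1/2::real" "Suc n"] unfolding A_def mem_Collect_eq mem_ball_0 by linarith
  have piece: "(\<integral>\<^sup>+z. ennreal (cmod (P z) powr s * (1 - cmod z) powr (-s)) * indicator (A n) z \<partial>lborel)
      \<le> ennreal (C * (2 powr (s - 1)) ^ Suc n)" for n
  proof -
    have b: "(1::real) - (1/2) ^ Suc n < 1" by simp
    note mv = annulus_mean_value[OF holf b, of "1 - (1/2) ^ n", folded A_def]
    have int: "integrable lborel (\<lambda>z. w n * Re (indicator (A n) z *\<^sub>R f z))"
      using mv(1) unfolding set_integrable_def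
      by (intro integrable_mult_right integrable_Re)
    have nn: "0 \<le> w n * Re (indicator (A n) z *\<^sub>R f z)" for z
    proof (cases "z \<in> A n")
      case True
      have "0 \<le> cmod (P z) powr s" by simp
      also have "\<dots> \<le> Re (f z) / \<kappa>" using le_f AD True by blast
      finally show ?thesis using \<kappa> w True by (auto simp: zero_le_divide_iff)
    qed simp
    have "(\<integral>\<^sup>+z. ennreal (cmod (P z) powr s * (1 - cmod z) powr (-s)) * indicator (A n) z \<partial>lborel)
      \<le> (\<integral>\<^sup>+z. ennreal (w n * Re (indicator (A n) z *\<^sub>R f z)) \<partial>lborel)"
    proof (rule nn_integral_mono)
      fix z :: complex
      show "ennreal (cmod (P z) powr s * (1 - cmod z) powr (-s)) * indicator (A n) z \<le>
          ennreal (w n * Re (indicator (A n) z *\<^sub>R f z))"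
      proof (cases "z \<in> A n")
        case True
        have le: "(1/2) ^ Suc n \<le> 1 - cmod z" using True by (simp add: A_def)
        have "(1 - cmod z) powr (-s) \<le> ((1/2) ^ Suc n) powr (-s)"
          using le s by (intro powr_mono2') auto
        also have "(1/2::real) ^ Suc n = 2 powr (- real (Suc n))"
          by (simp only: powr_minus powr_realpow) (simp add: power_divide field_simps)
        also have "\<dots> powr (-s) = (2 powr s) ^ Suc n"
          by (simp only: powr_powr powr_power) (simp add: algebra_simps)
        finally have "cmod (P z) powr s * (1 - cmod z) powr (-s) \<le> Re (f z) / \<kappa> * (2 powr s) ^ Suc n"
          using le_f[OF AD[OF True]] by (intro mult_mono) (auto intro: order_trans[OF powr_ge_zero])
        also have "\<dots> = w n * Re (f z)" by (simp add: w_def)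
        finally show ?thesis using True by (simp add: ennreal_leI)
      qed simp
    qed
    also have "\<dots> = ennreal (LINT z|lborel. w n * Re (indicator (A n) z *\<^sub>R f z))"
      using nn by (intro nn_integral_eq_integral int) auto
    also have "(LINT z|lborel. w n * Re (indicator (A n) z *\<^sub>R f z)) = w n * Re (LINT z:A n|lborel. f z)"
      using mv(1) unfolding set_lebesgue_integral_def set_integrable_def
      by (subst integral_mult_right_zero, subst integral_Re[symmetric]) auto
    also have "\<dots> = w n * (measure lborel (A n) * Re (f 0))"
      by (simp add: mv(2))
    also have "\<dots> \<le> w n * ((2 * pi * (1/2) ^ Suc n) * Re (f 0))"
    proof -
      have "measure lborel (A n) \<le> 2 * pi * ((1 - (1/2) ^ Suc n) - (1 - (1/2) ^ n))"
        unfolding A_def by (rule measure_annulus_le) (auto simp: power_le_one)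
      then show ?thesis
        using w f0 by (intro mult_left_mono mult_right_mono) auto
    qed
    also have "\<dots> = C * (2 powr (s - 1)) ^ Suc n"
    proof -
      have "(2 powr (s - 1)) ^ Suc n = (2 powr s) ^ Suc n * (1/2) ^ Suc n"
        by (simp only: powr_diff power_mult_distrib[symmetric]) simp
      then show ?thesis by (simp add: w_def C_def)
    qed
    finally show ?thesis by (simp add: ennreal_leI)
  qed
  have q: "norm (2 powr (s - 1)) < (1::real)"
    using s powr_less_mono[of "s - 1" 0 2] by simp
  have "(\<integral>\<^sup>+z. ennreal (cmod (P z) powr s * (1 - cmod z) powr (-s)) * indicator (ball 0 1) z \<partial>lborel)
     \<le> (\<integral>\<^sup>+z. (\<Sum>n. ennreal (cmod (P z) powr s * (1 - cmod z) powr (-s)) * indicator (A n) z) \<partial>lborel)"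
  proof (rule nn_integral_mono)
    fix z :: complex
    let ?g = "\<lambda>n. ennreal (cmod (P z) powr s * (1 - cmod z) powr (-s)) * indicator (A n) z"
    show "ennreal (cmod (P z) powr s * (1 - cmod z) powr (-s)) * indicator (ball 0 1) z \<le> (\<Sum>n. ?g n)"
    proof (cases "cmod z < 1")
      case True
      then obtain n where "z \<in> A n" using disk_dyadic_annulus[OF True] by (auto simp: A_def)
      then have "ennreal (cmod (P z) powr s * (1 - cmod z) powr (-s)) * indicator (ball 0 1) z = sum ?g {n}"
        using True by simp
      also have "\<dots> \<le> (\<Sum>n. ?g n)" by (intro sum_le_suminf) auto
      finally show ?thesis .
    qed simp
  qed
  also have "\<dots> = (\<Sum>n. \<integral>\<^sup>+z. ennreal (cmod (P z) powr s * (1 - cmod z) powr (-s)) * indicator (A n) z \<partial>lborel)"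
  proof (rule nn_integral_suminf)
    fix n
    have "continuous_on (A n) (\<lambda>z. cmod (P z) powr s * (1 - cmod z) powr (-s))"
    proof (intro continuous_intros continuous_on_subset[OF holomorphic_on_imp_continuous_on[OF P]])
      show "A n \<subseteq> ball 0 1" using AD by blast
      show "\<forall>z\<in>A n. cmod (P z) \<noteq> 0" using AD pos by force
      show "\<forall>z\<in>A n. 1 - cmod z \<noteq> 0" using AD by force
    qed
    then have "(\<lambda>z. indicator (A n) z *\<^sub>R (cmod (P z) powr s * (1 - cmod z) powr (-s))) \<in> borel_measurable borel"
      by (intro borel_measurable_continuous_on_indicator) auto
    then have "(\<lambda>z. ennreal (indicator (A n) z *\<^sub>R (cmod (P z) powr s * (1 - cmod z) powr (-s)))) \<in> borel_measurable lborel"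
      by simp
    also have "(\<lambda>z. ennreal (indicator (A n) z *\<^sub>R (cmod (P z) powr s * (1 - cmod z) powr (-s)))) =
       (\<lambda>z. ennreal (cmod (P z) powr s * (1 - cmod z) powr (-s)) * indicator (A n) z)"
      by (auto simp: indicator_def fun_eq_iff)
    finally show "(\<lambda>z. ennreal (cmod (P z) powr s * (1 - cmod z) powr (-s)) * indicator (A n) z) \<in> borel_measurable lborel" .
  qed
  also have "\<dots> \<le> (\<Sum>n. ennreal (C * (2 powr (s - 1)) ^ Suc n))"
    by (intro suminf_le piece) auto
  also have "\<dots> = ennreal (\<Sum>n. C * (2 powr (s - 1)) ^ Suc n)"
    using f0 \<kappa> q by (intro suminf_ennreal2) (auto simp: C_def intro!: summable_mult summable_geometric)
  also have "\<dots> < \<infinity>" by simp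
  finally show ?thesis .
qed

text \<open>
  Replacing \<open>P\<close> by \<open>P + 1\<close> increases the modulus and makes the real part positive.
\<close>

lemma nn_integral_disk_weighted_power:
  assumes P: "P holomorphic_on ball 0 1" and pos: "\<And>z. z \<in> ball 0 1 \<Longrightarrow> Re (P z) \<ge> 0"
    and s: "0 \<le> s" "s < 1"
  shows "(\<integral>\<^sup>+z. ennreal (cmod (P z) powr s * (1 - cmod z) powr (-s)) * indicator (ball 0 1) z \<partial>lborel) < \<infinity>"
proof -
  have "cmod (P z) \<le> cmod (P z + 1)" if "z \<in> ball 0 1" for z
    using pos[OF that] by (auto simp: cmod_def power2_eq_square algebra_simps)
  then have "(\<integral>\<^sup>+z. ennreal (cmod (P z) powr s * (1 - cmod z) powr (-s)) * indicator (ball 0 1) z \<partial>lborel) \<le>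
     (\<integral>\<^sup>+z. ennreal (cmod (P z + 1) powr s * (1 - cmod z) powr (-s)) * indicator (ball 0 1) z \<partial>lborel)"
    using s by (intro nn_integral_mono) (auto simp: indicator_def intro!: ennreal_leI mult_right_mono powr_mono2)
  also have "\<dots> < \<infinity>"
    using pos by (intro nn_integral_disk_weighted_power_pos holomorphic_intros P s) (simp add: add_nonneg_pos)
  finally show ?thesis .
qed

section \<open>Schwarz-Pick and Harnack bounds for functions with nonnegative real part\<close>

text \<open>
  Both bounds are the Schwarz lemma for \<open>(P - P 0) / (P + cnj (P 0))\<close>, which maps the disk to
  itself because \<open>P\<close> maps it to the right half-plane. The second one is Harnack's inequality.
\<close>

lemma Re_pos_disk_Schwarz:
  assumes P: "P holomorphic_on ball 0 1" and pos: "\<And>z. cmod z < 1 \<Longrightarrow> Re (P z) > 0"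
  shows "cmod (deriv P 0) \<le> 2 * Re (P 0)"
    and "cmod z < 1 \<Longrightarrow> Re (P 0) * ((1 - cmod z) / (1 + cmod z)) \<le> Re (P z)"
proof -
  define f where "f z = (P z - P 0) / (P z + cnj (P 0))" for z
  have nz: "P z + cnj (P 0) \<noteq> 0" if "cmod z < 1" for z
  proof -
    have "Re (P z + cnj (P 0)) > 0" using pos[OF that] pos[of 0] by simp
    then show ?thesis by force
  qed
  have holf: "f holomorphic_on ball 0 1"
    unfolding f_def using nz by (intro holomorphic_intros P) auto
  have f0: "f 0 = 0" by (simp add: f_def)
  have f1: "cmod (f z) < 1" if "cmod z < 1" for z
  proof -
    have "0 < Re (P z) * Re (P 0)" using pos[OF that] pos[of 0] by simp
    then have "(cmod (P z - P 0))\<^sup>2 < (cmod (P z + cnj (P 0)))\<^sup>2"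
      by (simp only: cmod_power2) (simp add: power2_eq_square algebra_simps)
    then have "cmod (P z - P 0) < cmod (P z + cnj (P 0))"
      by (rule power_less_imp_less_base) simp
    then show ?thesis using nz[OF that] by (simp add: f_def norm_divide)
  qed
  have "(P has_field_derivative deriv P 0) (at 0)"
    using holomorphic_derivI[OF P, of 0] by simp
  then have "(f has_field_derivative
     ((deriv P 0 - 0) * (P 0 + cnj (P 0)) - (P 0 - P 0) * (deriv P 0 + 0)) / ((P 0 + cnj (P 0)) * (P 0 + cnj (P 0)))) (at 0)"
    unfolding f_def using nz[of 0] by (intro derivative_intros) auto
  then have "deriv f 0 = deriv P 0 / (P 0 + cnj (P 0))"
    using nz[of 0] by (simp add: DERIV_imp_deriv)
  moreover have "cmod (P 0 + cnj (P 0)) = 2 * Re (P 0)"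
    using pos[of 0] by (simp add: complex_add_cnj norm_mult)
  moreover have "cmod (deriv f 0) \<le> 1"
    using Schwarz_Lemma(2)[OF holf f0 f1, of 0] by simp
  ultimately show "cmod (deriv P 0) \<le> 2 * Re (P 0)"
    using pos[of 0] by (simp add: norm_divide divide_le_eq)
  assume z: "cmod z < 1"
  define r a x where "r = cmod z" and "a = Re (P 0)" and "x = Re (P z)"
  have a: "a > 0" and x: "x > 0" and r: "0 \<le> r" "r < 1"
    using pos[OF z] pos[of 0] z by (auto simp: a_def x_def r_def)
  have "cmod (f z) \<le> r" unfolding r_def using Schwarz_Lemma(1)[OF holf f0 f1 z] by simp
  then have "cmod (P z - P 0) \<le> r * cmod (P z + cnj (P 0))"
    using nz[OF z] by (simp add: f_def norm_divide divide_le_eq)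
  from power_mono[OF this norm_ge_zero, of 2]
  have "(cmod (P z - P 0))\<^sup>2 \<le> r\<^sup>2 * (cmod (P z + cnj (P 0)))\<^sup>2"
    by (simp add: power_mult_distrib)
  then have "(x - a)\<^sup>2 + (Im (P z) - Im (P 0))\<^sup>2 \<le> r\<^sup>2 * ((x + a)\<^sup>2 + (Im (P z) - Im (P 0))\<^sup>2)"
    by (simp add: cmod_power2 x_def a_def)
  moreover have "r\<^sup>2 * (Im (P z) - Im (P 0))\<^sup>2 \<le> 1 * (Im (P z) - Im (P 0))\<^sup>2"
    using r by (intro mult_right_mono) (auto simp: power_le_one)
  ultimately have "(x - a)\<^sup>2 \<le> r\<^sup>2 * (x + a)\<^sup>2"
    by (simp add: algebra_simps)
  then have "(x - a)\<^sup>2 \<le> (r * (x + a))\<^sup>2"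
    by (simp only: power_mult_distrib)
  then have "\<bar>x - a\<bar> \<le> \<bar>r * (x + a)\<bar>"
    by (simp only: abs_le_square_iff)
  also have "\<bar>r * (x + a)\<bar> = r * (x + a)" using r a x by simp
  finally have "\<bar>x - a\<bar> \<le> r * (x + a)" .
  then have "a * (1 - r) \<le> x * (1 + r)"
    by (simp add: abs_le_iff algebra_simps)
  then show "Re (P 0) * ((1 - cmod z) / (1 + cmod z)) \<le> Re (P z)"
    using r by (simp add: a_def x_def r_def pos_divide_le_eq add_pos_nonneg)
qed

lemma Re_nonneg_disk_deriv_le:
  assumes P: "P holomorphic_on ball 0 1" and nn: "\<And>z. cmod z < 1 \<Longrightarrow> Re (P z) \<ge> 0"
  shows "cmod (deriv P 0) \<le> 2 * Re (P 0)"
proof (rule field_le_epsilon)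
  fix e :: real assume e: "e > 0"
  have "(P has_field_derivative deriv P 0) (at 0)"
    using holomorphic_derivI[OF P, of 0] by simp
  then have "((\<lambda>z. P z + of_real (e/2)) has_field_derivative deriv P 0 + 0) (at 0)"
    by (intro derivative_intros)
  then have "deriv (\<lambda>z. P z + of_real (e/2)) 0 = deriv P 0"
    by (simp add: DERIV_imp_deriv)
  moreover have "cmod (deriv (\<lambda>z. P z + of_real (e/2)) 0) \<le> 2 * Re (P 0 + of_real (e/2))"
    using nn e by (intro Re_pos_disk_Schwarz(1) holomorphic_intros P) (simp add: add_nonneg_pos)
  ultimately show "cmod (deriv P 0) \<le> 2 * Re (P 0) + e" by simp
qed

lemma Re_Cayley:
  assumes "z \<noteq> 1"
  shows "Re ((1 + z) / (1 - z)) = (1 - (cmod z)\<^sup>2) / (cmod (1 - z))\<^sup>2"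
  unfolding Re_divide cmod_power2 by (simp add: algebra_simps power2_eq_square)

lemma Re_Cayley_pos:
  assumes "cmod z < 1"
  shows "Re ((1 + z) / (1 - z)) > 0"
proof -
  have "z \<noteq> 1" using assms by auto
  moreover have "(cmod z)\<^sup>2 < 1" using assms by (simp add: power_less_one_iff)
  ultimately show ?thesis by (subst Re_Cayley) auto
qed

text \<open>
  The Schwarz-Pick inequality for maps of the half-plane: a Cayley transform with value \<open>w\<close> at 0 reduces
  it to the derivative bound at the centre of the disk.
\<close>

lemma half_plane_deriv_le:
  assumes H: "H holomorphic_on {w. Re w > 0}" and nn: "\<And>w. Re w > 0 \<Longrightarrow> Re (H w) \<ge> 0"
    and w: "Re w > 0"
  shows "cmod (deriv H w) * Re w \<le> Re (H w)"
proof -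
  define C where "C z = of_real (Re w) * ((1 + z) / (1 - z)) + \<i> * of_real (Im w)" for z
  have C0: "C 0 = w" by (simp add: C_def complex_eq_iff)
  have Cpos: "Re (C z) > 0" if "cmod z < 1" for z
  proof -
    have "Re (C z) = Re w * Re ((1 + z) / (1 - z))"
      unfolding C_def plus_complex.sel times_complex.sel by simp
    then show ?thesis using Re_Cayley_pos[OF that] w by simp
  qed
  have holC: "C holomorphic_on ball 0 1"
    unfolding C_def by (intro holomorphic_intros) auto
  have "((\<lambda>z. (1 + z) / (1 - z)) has_field_derivative 2) (at (0::complex))"
    by (auto intro!: derivative_eq_intros)
  then have "(C has_field_derivative of_real (Re w) * 2 + 0) (at 0)"
    unfolding C_def by (intro derivative_intros DERIV_cmult)
  then have dC: "(C has_field_derivative 2 * of_real (Re w)) (at 0)" by (simp add: mult.commute)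
  have "open {w. 0 < Re w}" by (simp add: open_halfspace_Re_gt)
  then have "(H has_field_derivative deriv H w) (at (C 0))"
    using holomorphic_derivI[OF H, of w] w by (simp add: C0)
  from DERIV_chain[OF this dC] have "deriv (H \<circ> C) 0 = deriv H w * (2 * of_real (Re w))"
    by (rule DERIV_imp_deriv)
  moreover have "cmod (deriv (H \<circ> C) 0) \<le> 2 * Re ((H \<circ> C) 0)"
    using Cpos nn by (intro Re_nonneg_disk_deriv_le holomorphic_on_compose_gen[OF holC H]) auto
  ultimately show ?thesis using w by (simp add: C0 norm_mult)
qed

text \<open>
  The half-plane bound for the lift \<open>w \<mapsto> P (exp (-w))\<close>. Its weight \<open>ln (1/\<bar>z\<bar>)\<close> is the one that
  makes the monotonicity argument for flows fixing the origin exact.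
\<close>

lemma disk_log_deriv_le:
  assumes P: "P holomorphic_on ball 0 1" and nn: "\<And>z. cmod z < 1 \<Longrightarrow> Re (P z) \<ge> 0"
    and z: "cmod z < 1" "z \<noteq> 0"
  shows "cmod (deriv P z) * cmod z * (- ln (cmod z)) \<le> Re (P z)"
proof -
  define w where "w = - Ln z"
  have ez: "exp (- w) = z" using z by (simp add: w_def)
  have Rew: "Re w = - ln (cmod z)" using z by (simp add: w_def)
  then have w: "Re w > 0" using z by simp
  have "(P has_field_derivative deriv P z) (at (exp (- w)))"
    using holomorphic_derivI[OF P, of z] z by (simp add: ez)
  moreover have "((\<lambda>w. exp (- w)) has_field_derivative - z) (at w)"
    by (auto intro!: derivative_eq_intros simp: ez)
  ultimately have "((\<lambda>w. P (exp (- w))) has_field_derivative deriv P z * (- z)) (at w)"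
    by (rule DERIV_chain2)
  then have "deriv (\<lambda>w. P (exp (- w))) w = - (deriv P z * z)"
    by (simp add: DERIV_imp_deriv)
  moreover have "cmod (deriv (\<lambda>w. P (exp (- w))) w) * Re w \<le> Re (P (exp (- w)))"
  proof (rule half_plane_deriv_le[where H = "\<lambda>w. P (exp (- w))"])
    show "(\<lambda>w. P (exp (- w))) holomorphic_on {w. 0 < Re w}"
      by (rule holomorphic_on_compose_gen[OF _ P, unfolded o_def]) (auto intro!: holomorphic_intros)
  qed (use nn w in auto)
  ultimately show ?thesis by (simp add: ez Rew norm_mult)
qed

text \<open>
  Otherwise the image is open and reaches into the left half-plane.
\<close>

lemma Re_nonneg_vanishing_imp_constant:
  assumes P: "P holomorphic_on S" and S: "open S" "connected S"
    and nn: "\<And>z. z \<in> S \<Longrightarrow> Re (P z) \<ge> 0" and z: "z \<in> S" "Re (P z) = 0"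
  shows "P constant_on S"
proof (rule ccontr)
  assume "\<not> P constant_on S"
  with open_mapping_thm[OF P S S(1) subset_refl] have "open (P ` S)" by simp
  then obtain e where e: "e > 0" "ball (P z) e \<subseteq> P ` S"
    using z(1) by (meson imageI open_contains_ball)
  have "P z - of_real (e/2) \<in> ball (P z) e"
    using e(1) by (simp add: dist_norm)
  then obtain y where "y \<in> S" "P y = P z - of_real (e/2)" using e(2) by (metis imageE subsetD)
  then show False using nn[of y] z e(1) by simp
qed

lemma Re_nonneg_disk_lower_bound:
  assumes P: "P holomorphic_on ball 0 1" and nn: "\<And>z. cmod z < 1 \<Longrightarrow> Re (P z) \<ge> 0"
    and nz: "cmod a < 1" "P a \<noteq> 0"
  obtains c where "c > 0" "\<And>z. cmod z < 1 \<Longrightarrow> c * (1 - cmod z) \<le> cmod (P z)"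
proof (cases "\<exists>z. cmod z < 1 \<and> Re (P z) = 0")
  case True
  then have "P constant_on ball 0 1"
    using Re_nonneg_vanishing_imp_constant[OF P] nn by auto
  then obtain k where k: "P z = k" if "cmod z < 1" for z
    by (auto simp: constant_on_def)
  then have "cmod k > 0" using nz by auto
  then show thesis
    using k by (intro that[of "cmod k"]) (auto simp: mult_left_le)
next
  case False
  then have pos: "Re (P z) > 0" if "cmod z < 1" for z using nn[OF that] that by force
  show thesis
  proof (rule that[of "Re (P 0) / 2"])
    show "Re (P 0) / 2 > 0" using pos[of 0] by simp
    fix z :: complex assume z: "cmod z < 1"
    have "(1 - cmod z) / 2 \<le> (1 - cmod z) / (1 + cmod z)"
      using z by (intro divide_left_mono) (auto intro: add_pos_nonneg)
    then have "Re (P 0) * ((1 - cmod z) / 2) \<le> Re (P 0) * ((1 - cmod z) / (1 + cmod z))"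
      using pos[of 0] by (intro mult_left_mono) auto
    also have "\<dots> \<le> Re (P z)" by (rule Re_pos_disk_Schwarz(2)[OF P pos z])
    also have "\<dots> \<le> cmod (P z)" by (rule complex_Re_le_cmod)
    finally show "Re (P 0) / 2 * (1 - cmod z) \<le> cmod (P z)" by simp
  qed
qed

section \<open>The infinitesimal generator of a semigroup\<close>

lemma continuous_conformal_semigroupD:
  assumes "continuous_conformal_semigroup \<phi>"
  shows "\<And>t. t \<ge> 0 \<Longrightarrow> \<phi> t holomorphic_on ball 0 1"
    and "\<And>t. t \<ge> 0 \<Longrightarrow> inj_on (\<phi> t) (ball 0 1)"
    and "\<And>t z. t \<ge> 0 \<Longrightarrow> cmod z < 1 \<Longrightarrow> cmod (\<phi> t z) < 1"
    and "\<And>z. cmod z < 1 \<Longrightarrow> \<phi> 0 z = z"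
    and "\<And>s t z. s \<ge> 0 \<Longrightarrow> t \<ge> 0 \<Longrightarrow> cmod z < 1 \<Longrightarrow> \<phi> (t + s) z = \<phi> t (\<phi> s z)"
    and "\<And>z. cmod z < 1 \<Longrightarrow> continuous_on {0..} (\<lambda>t. \<phi> t z)"
proof -
  show "cmod (\<phi> t z) < 1" if "t \<ge> 0" "cmod z < 1" for t z
  proof -
    have "\<phi> t z \<in> \<phi> t ` ball 0 1" using that by auto
    then show ?thesis
      using assms that unfolding continuous_conformal_semigroup_def conformal_self_map_def by fastforce
  qed
qed (use assms in \<open>auto simp: continuous_conformal_semigroup_def conformal_self_map_def\<close>)

lemma disk_self_map_higher_deriv_le:
  assumes f: "f holomorphic_on ball 0 1" and f1: "\<And>z. cmod z < 1 \<Longrightarrow> cmod (f z) < 1"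
    and z: "cmod z < 1" and n: "n > 0"
  shows "cmod ((deriv ^^ n) f z) \<le> fact n / ((1 - cmod z) / 2) ^ n"
proof -
  define r where "r = (1 - cmod z) / 2"
  have r: "r > 0" using z by (simp add: r_def)
  have sub: "cball z r \<subseteq> ball 0 1"
  proof
    fix w assume "w \<in> cball z r"
    then have "cmod (w - z) \<le> r" by (simp add: dist_norm norm_minus_commute)
    moreover have "cmod w \<le> cmod z + cmod (w - z)" by (metis add.commute diff_add_cancel norm_triangle_ineq)
    ultimately show "w \<in> ball 0 1" using z by (simp add: r_def field_simps)
  qed
  have "cmod ((deriv ^^ n) f z) \<le> fact n * 1 / r ^ n"
  proof (rule Cauchy_higher_deriv_bound[where y = 0])
    show "f holomorphic_on ball z r"
      using sub ball_subset_cball[of z r] by (intro holomorphic_on_subset[OF f]) auto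
    show "continuous_on (cball z r) f"
      using sub by (intro continuous_on_subset[OF holomorphic_on_imp_continuous_on[OF f]])
    show "f w \<in> ball 0 1" if "w \<in> ball z r" for w
    proof -
      have "w \<in> ball 0 1" using that sub ball_subset_cball[of z r] by blast
      then show ?thesis using f1[of w] by simp
    qed
  qed (use r n in auto)
  then show ?thesis by (simp add: r_def)
qed

lemma disk_self_map_deriv_Lipschitz:
  assumes f: "f holomorphic_on ball 0 1" and f1: "\<And>z. cmod z < 1 \<Longrightarrow> cmod (f z) < 1"
    and r: "r < 1" and z: "cmod z < r" "cmod w < r"
  shows "cmod (deriv f z - deriv f w) \<le> 8 / (1 - r)\<^sup>2 * cmod (z - w)"
proof (rule field_differentiable_bound[where S = "ball 0 r"])
  fix x :: complex assume x: "x \<in> ball 0 r"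
  then have x1: "cmod x < 1" using r by simp
  have "(deriv f has_field_derivative deriv (deriv f) x) (at x)"
    using holomorphic_derivI[OF holomorphic_deriv[OF f], of x] x1 by simp
  then show "(deriv f has_field_derivative deriv (deriv f) x) (at x within ball 0 r)"
    by (rule has_field_derivative_at_within)
  have "cmod ((deriv ^^ 2) f x) \<le> fact 2 / ((1 - cmod x) / 2) ^ 2"
    by (rule disk_self_map_higher_deriv_le[OF f f1 x1]) auto
  also have "\<dots> \<le> fact 2 / ((1 - r) / 2) ^ 2"
    using x x1 r by (intro divide_left_mono power_mono) auto
  also have "\<dots> = 8 / (1 - r)\<^sup>2" by (simp add: power_divide)
  finally show "cmod (deriv (deriv f) x) \<le> 8 / (1 - r)\<^sup>2"
    by (simp add: numeral_2_eq_2)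
qed (use z in auto)

text \<open>
  Difference quotients in space are continuous in time by assumption, and Cauchy's estimates for the
  second derivative make their convergence to the derivative uniform in time.
\<close>

lemma semigroup_deriv_continuous_time:
  assumes S: "continuous_conformal_semigroup \<phi>" and z: "cmod z < 1"
  shows "continuous_on {0..} (\<lambda>s. deriv (\<phi> s) z)"
proof -
  note SD = continuous_conformal_semigroupD[OF S]
  define r where "r = (1 + cmod z) / 2"
  have r: "cmod z < r" "r < 1" using z by (auto simp: r_def)
  define M where "M = 8 / (1 - r)\<^sup>2"
  have M: "M > 0" using r by (simp add: M_def)
  define h where "h n = (r - cmod z) / (real n + 2)" for n
  have h_less: "h n < r - cmod z" for n
  proof -
    have "(r - cmod z) / (real n + 2) < (r - cmod z) / 1"
      using r by (intro divide_strict_left_mono) auto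
    then show ?thesis by (simp add: h_def)
  qed
  have h: "h n > 0" "cmod (z + of_real (h n)) < r" for n
  proof -
    show "h n > 0" using r by (simp add: h_def)
    have "cmod (z + of_real (h n)) \<le> cmod z + \<bar>h n\<bar>"
      using norm_triangle_ineq[of z "of_real (h n)"] by simp
    then show "cmod (z + of_real (h n)) < r" using \<open>h n > 0\<close> h_less[of n] by linarith
  qed
  have h0: "h \<longlonglongrightarrow> 0" unfolding h_def by real_asymp
  define q where "q n s = (\<phi> s (z + of_real (h n)) - \<phi> s z) / of_real (h n)" for n s
  have bound: "cmod (q n s - deriv (\<phi> s) z) \<le> M * h n" if s: "s \<ge> 0" for n s
  proof -
    let ?B = "cball z (h n)"
    have inB: "cmod x < r" if "x \<in> ?B" for x
    proof -
      have "cmod x \<le> cmod z + cmod (x - z)" by (metis add.commute diff_add_cancel norm_triangle_ineq)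
      moreover have "cmod (x - z) \<le> h n" using that by (simp add: dist_norm norm_minus_commute)
      ultimately show ?thesis using h_less[of n] by linarith
    qed
    have "cmod ((\<phi> s (z + of_real (h n)) - deriv (\<phi> s) z * (z + of_real (h n))) - (\<phi> s z - deriv (\<phi> s) z * z))
       \<le> (M * h n) * cmod ((z + of_real (h n)) - z)"
    proof (rule field_differentiable_bound[where S = ?B and f' = "\<lambda>x. deriv (\<phi> s) x - deriv (\<phi> s) z"])
      fix x assume x: "x \<in> ?B"
      have "(\<phi> s has_field_derivative deriv (\<phi> s) x) (at x)"
        using holomorphic_derivI[OF SD(1)[OF s], of x] inB[OF x] r by simp
      then have "((\<lambda>x. \<phi> s x - deriv (\<phi> s) z * x) has_field_derivative deriv (\<phi> s) x - deriv (\<phi> s) z * 1) (at x)"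
        by (intro derivative_intros DERIV_cmult)
      then show "((\<lambda>x. \<phi> s x - deriv (\<phi> s) z * x) has_field_derivative deriv (\<phi> s) x - deriv (\<phi> s) z) (at x within ?B)"
        by (simp add: has_field_derivative_at_within)
      have "cmod (deriv (\<phi> s) x - deriv (\<phi> s) z) \<le> M * cmod (x - z)"
        unfolding M_def using inB[OF x] r SD(3)[OF s]
        by (intro disk_self_map_deriv_Lipschitz SD(1)[OF s]) auto
      also have "\<dots> \<le> M * h n" using x M by (simp add: dist_norm norm_minus_commute)
      finally show "cmod (deriv (\<phi> s) x - deriv (\<phi> s) z) \<le> M * h n" .
    qed (use h in \<open>auto simp: dist_norm less_imp_le\<close>)
    note * = this
    have "cmod ((q n s - deriv (\<phi> s) z) * of_real (h n)) \<le> (M * h n) * h n"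
    proof -
      have "(q n s - deriv (\<phi> s) z) * of_real (h n) =
         (\<phi> s (z + of_real (h n)) - deriv (\<phi> s) z * (z + of_real (h n))) - (\<phi> s z - deriv (\<phi> s) z * z)"
      proof -
        have "q n s * of_real (h n) = \<phi> s (z + of_real (h n)) - \<phi> s z"
          using h(1)[of n] by (simp add: q_def)
        then show ?thesis by (simp add: left_diff_distrib distrib_left)
      qed
      then show ?thesis using * h(1)[of n] by simp
    qed
    then show ?thesis using h(1)[of n] by (simp add: norm_mult)
  qed
  have "uniform_limit {0..} q (\<lambda>s. deriv (\<phi> s) z) sequentially"
  proof (rule uniform_limitI)
    fix e :: real assume e: "e > 0"
    have "(\<lambda>n. M * h n) \<longlonglongrightarrow> 0" using tendsto_mult_right_zero[OF h0] by simp
    then have "\<forall>\<^sub>F n in sequentially. M * h n < e" using e by (rule order_tendstoD)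
    then show "\<forall>\<^sub>F n in sequentially. \<forall>s\<in>{0..}. dist (q n s) (deriv (\<phi> s) z) < e"
    proof eventually_elim
      case (elim n)
      show ?case
      proof
        fix s :: real assume "s \<in> {0..}"
        then have "dist (q n s) (deriv (\<phi> s) z) \<le> M * h n"
          using bound[of s n] by (simp add: dist_norm)
        then show "dist (q n s) (deriv (\<phi> s) z) < e" using elim by linarith
      qed
    qed
  qed
  moreover have "continuous_on {0..} (q n)" for n
    unfolding q_def using h(1)[of n] h(2)[of n] r z
    by (intro continuous_intros SD(6)) auto
  ultimately show ?thesis
    by (intro uniform_limit_theorem[where f = q and F = sequentially]) auto
qed

text \<open>
  The time average of the flow over \<open>[0, d]\<close> is the tool for differentiating in time: it is
  holomorphic in the starting point, and along an orbit it is differentiable in time by the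
  fundamental theorem of calculus, although the orbit itself is only assumed continuous.
\<close>

lemma semigroup_time_average_has_derivative:
  assumes S: "continuous_conformal_semigroup \<phi>" and z: "cmod z < 1"
  shows "((\<lambda>z. integral {0..d} (\<lambda>s. \<phi> s z)) has_field_derivative integral {0..d} (\<lambda>s. deriv (\<phi> s) z)) (at z)"
proof -
  note SD = continuous_conformal_semigroupD[OF S]
  define r where "r = (1 + cmod z) / 2"
  have r: "cmod z < r" "r < 1" using z by (auto simp: r_def)
  have "((\<lambda>z. integral (cbox 0 d) (\<lambda>s. \<phi> s z)) has_field_derivative integral (cbox 0 d) (\<lambda>s. deriv (\<phi> s) z)) (at z within ball 0 r)"
  proof (rule leibniz_rule_field_derivative)
    fix x s assume "x \<in> ball (0::complex) r" "s \<in> cbox 0 d"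
    then show "((\<lambda>x. \<phi> s x) has_field_derivative deriv (\<phi> s) x) (at x within ball 0 r)"
      using r holomorphic_derivI[OF SD(1)[of s], of x] by (simp add: has_field_derivative_at_within)
  next
    fix x assume "x \<in> ball (0::complex) r"
    then have "continuous_on {0..d} (\<lambda>s. \<phi> s x)"
      using r by (intro continuous_on_subset[OF SD(6)]) auto
    then show "(\<lambda>s. \<phi> s x) integrable_on cbox 0 d"
      using integrable_continuous_real by auto
  next
    have "continuous_on ({0..d} \<times> ball 0 r) (\<lambda>(s, x). deriv (\<phi> s) x)"
    proof (rule Lipschitz.continuous_on_TimesI)
      have "(8 / (1 - r)\<^sup>2)-lipschitz_on (ball 0 r) (\<lambda>x. deriv (\<phi> s) x)" if "s \<in> {0..d}" for s
      proof (rule lipschitz_onI)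
        fix x y :: complex assume "x \<in> ball 0 r" "y \<in> ball 0 r"
        then show "dist (deriv (\<phi> s) x) (deriv (\<phi> s) y) \<le> 8 / (1 - r)\<^sup>2 * dist x y"
          unfolding dist_norm using that r SD(3)[of s]
          by (intro disk_self_map_deriv_Lipschitz SD(1)) auto
      qed simp
      then have "(8 / (1 - r)\<^sup>2)-lipschitz_on (cball x 1 \<inter> ball 0 r) (\<lambda>x. deriv (\<phi> s) x)" if "s \<in> {0..d}" for x s
        using that lipschitz_on_subset[of "8 / (1 - r)\<^sup>2" "ball 0 r" "\<lambda>x. deriv (\<phi> s) x"] by auto
      then show "local_lipschitz {0..d} (ball 0 r) (\<lambda>s x. deriv (\<phi> s) x)"
        by (intro local_lipschitzI exI[of _ "1::real"] conjI exI[of _ "8 / (1 - r)\<^sup>2"] ballI) auto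
      show "continuous_on {0..d} (\<lambda>s. deriv (\<phi> s) x)" if "x \<in> ball 0 r" for x
        using that r by (intro continuous_on_subset[OF semigroup_deriv_continuous_time[OF S]]) auto
    qed
    then have "continuous_on (ball 0 r \<times> {0..d}) (\<lambda>p. (\<lambda>(s, x). deriv (\<phi> s) x) (snd p, fst p))"
      by (rule continuous_on_compose2) (auto intro!: continuous_intros)
    then show "continuous_on (ball 0 r \<times> cbox 0 d) (\<lambda>(x, s). deriv (\<phi> s) x)"
      by (simp add: case_prod_beta)
  qed (use r in auto)
  then show ?thesis using r by (simp add: at_within_open[of z "ball 0 r"])
qed

lemma semigroup_time_average_deriv_nonzero:
  assumes S: "continuous_conformal_semigroup \<phi>" and z: "cmod z < 1"
  obtains d where "d > 0" "integral {0..d} (\<lambda>s. deriv (\<phi> s) z) \<noteq> 0"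
proof -
  note SD = continuous_conformal_semigroupD[OF S]
  have "(\<phi> 0 has_field_derivative 1) (at z)"
  proof (rule has_field_derivative_transform_within_open[where f = "\<lambda>z. z" and S = "ball 0 1"])
  qed (use z SD(4) in \<open>auto intro!: derivative_eq_intros\<close>)
  then have d0: "deriv (\<phi> 0) z = 1" by (rule DERIV_imp_deriv)
  have cont: "continuous_on {0..} (\<lambda>s. deriv (\<phi> s) z)"
    by (rule semigroup_deriv_continuous_time[OF S z])
  then have "\<exists>e>0. \<forall>s\<in>{0..}. dist s 0 < e \<longrightarrow> dist (deriv (\<phi> s) z) (deriv (\<phi> 0) z) < 1/2"
    unfolding continuous_on_iff by (metis atLeast_iff half_gt_zero_iff order_refl zero_less_one)
  then obtain e where e: "e > 0" "\<And>s. s \<ge> 0 \<Longrightarrow> s < e \<Longrightarrow> cmod (deriv (\<phi> s) z - 1) < 1/2"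
    by (auto simp: dist_norm d0)
  define d where "d = e / 2"
  have d: "d > 0" "d < e" using e by (auto simp: d_def)
  have int: "(\<lambda>s. deriv (\<phi> s) z) integrable_on {0..d}"
    using continuous_on_subset[OF cont, of "{0..d}"] by (intro integrable_continuous_real) auto
  have "integral {0..d} (\<lambda>s. 1/2 :: real) \<le> integral {0..d} (\<lambda>s. Re (deriv (\<phi> s) z))"
  proof (rule integral_le)
    show "(\<lambda>s. Re (deriv (\<phi> s) z)) integrable_on {0..d}"
      using continuous_on_subset[OF cont, of "{0..d}"]
      by (intro integrable_continuous_real continuous_intros) auto
    fix s assume "s \<in> {0..d}"
    then have "cmod (deriv (\<phi> s) z - 1) < 1/2" using d by (intro e) auto
    then show "1/2 \<le> Re (deriv (\<phi> s) z)"
      using abs_Re_le_cmod[of "deriv (\<phi> s) z - 1"] by (simp; linarith)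
  qed auto
  also have "\<dots> = Re (integral {0..d} (\<lambda>s. deriv (\<phi> s) z))"
    using integral_linear[OF int bounded_linear_Re] by (simp add: o_def)
  finally have "Re (integral {0..d} (\<lambda>s. deriv (\<phi> s) z)) > 0"
    using d by (simp add: field_simps)
  then show thesis using that[OF d(1)] by force
qed

text \<open>
  With \<open>A\<close> the time average, \<open>A (\<phi>\<^sub>h z)\<close> is the integral of the orbit over \<open>[h, h + d]\<close>, hence differentiable
  in \<open>h\<close>. Where \<open>A'\<close> does not vanish, \<open>A\<close> has a local holomorphic inverse, which recovers
  the orbit itself.
\<close>

lemma semigroup_has_time_derivative:
  assumes S: "continuous_conformal_semigroup \<phi>" and z: "cmod z < 1" and s: "s \<ge> 0" and d: "d > 0"
    and nz: "integral {0..d} (\<lambda>r. deriv (\<phi> r) (\<phi> s z)) \<noteq> 0"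
  shows "((\<lambda>t. \<phi> t z) has_vector_derivative
     (\<phi> d (\<phi> s z) - \<phi> s z) / integral {0..d} (\<lambda>r. deriv (\<phi> r) (\<phi> s z))) (at s within {0..})"
proof -
  note SD = continuous_conformal_semigroupD[OF S]
  define w where "w = \<phi> s z"
  have w: "cmod w < 1" unfolding w_def using SD(3) s z by auto
  define A where "A z = integral {0..d} (\<lambda>r. \<phi> r z)" for z
  define A' where "A' z = integral {0..d} (\<lambda>r. deriv (\<phi> r) z)" for z
  have derA: "(A has_field_derivative A' z) (at z)" if "cmod z < 1" for z
    unfolding A_def A'_def by (rule semigroup_time_average_has_derivative[OF S that])
  have holA: "A holomorphic_on ball 0 1"
    using derA by (auto simp: holomorphic_on_open intro!: exI derA)
  have A'w: "deriv A w = A' w" "A' w \<noteq> 0"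
    using derA[OF w] nz by (auto simp: DERIV_imp_deriv A'_def w_def)
  define J where "J x = integral {0..x} (\<lambda>r. \<phi> r z)" for x
  have derJ: "(J has_vector_derivative \<phi> x z) (at x within {0..})" if x: "x \<ge> 0" for x
  proof -
    have "continuous_on {0..x+1} (\<lambda>r. \<phi> r z)"
      by (rule continuous_on_subset[OF SD(6)[OF z]]) auto
    then have "(J has_vector_derivative \<phi> x z) (at x within {0..x+1})"
      unfolding J_def using x by (intro integral_has_vector_derivative) auto
    also have "at x within {0..x+1} = at x within {0..}"
      using x by (intro at_within_nhd[of _ "{..<x+1}"]) auto
    finally show ?thesis .
  qed
  have shift: "A (\<phi> h z) = J (h + d) - J h" if h: "h \<ge> 0" for h
  proof -
    have c: "continuous_on {0..h+d} (\<lambda>r. \<phi> r z)" "continuous_on {0+h..d+h} (\<lambda>r. \<phi> r z)"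
      using h d by (auto intro!: continuous_on_subset[OF SD(6)[OF z]])
    have "A (\<phi> h z) = integral {0..d} ((\<lambda>r. \<phi> r z) \<circ> (\<lambda>r. r + h))"
      unfolding A_def using SD(5)[OF h _ z] by (intro integral_cong) auto
    also have "\<dots> = integral {h..h+d} (\<lambda>r. \<phi> r z)"
      using integral_shift[OF c(2)] by (simp add: add.commute)
    also have "\<dots> = J (h + d) - J h"
      unfolding J_def using Henstock_Kurzweil_Integration.integral_combine[of 0 h "h+d" "\<lambda>r. \<phi> r z"]
        integrable_continuous_real[OF c(1)] h d by (simp add: algebra_simps)
    finally show ?thesis .
  qed
  have "((J \<circ> (\<lambda>h. h + d)) has_vector_derivative 1 *\<^sub>R \<phi> (s + d) z) (at s within {0..})"
  proof (rule vector_diff_chain_within)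
    show "((\<lambda>h. h + d) has_vector_derivative 1) (at s within {0..})"
      by (auto intro!: derivative_eq_intros)
    show "(J has_vector_derivative \<phi> (s + d) z) (at (s + d) within (\<lambda>h. h + d) ` {0..})"
      using s d by (intro has_vector_derivative_within_subset[OF derJ]) auto
  qed
  then have "((\<lambda>h. J (h + d) - J h) has_vector_derivative \<phi> (s + d) z - \<phi> s z) (at s within {0..})"
    using derJ[OF s] by (auto intro!: derivative_eq_intros simp: o_def)
  moreover have "\<phi> (s + d) z = \<phi> d w"
    unfolding w_def using SD(5)[OF s _ z, of d] d by (simp add: add.commute)
  ultimately have derT: "((\<lambda>h. A (\<phi> h z)) has_vector_derivative \<phi> d w - w) (at s within {0..})"
    using s by (auto intro: has_vector_derivative_transform[rotated 2] simp: shift w_def)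
  obtain \<rho> where \<rho>: "\<rho> > 0" "ball w \<rho> \<subseteq> ball 0 1" "inj_on A (ball w \<rho>)"
    using has_complex_derivative_locally_injective[OF holA, of w] w A'w by auto
  have holA\<rho>: "A holomorphic_on ball w \<rho>" using holA \<rho>(2) by (rule holomorphic_on_subset)
  obtain g where g: "g holomorphic_on A ` ball w \<rho>"
      "\<And>x. x \<in> ball w \<rho> \<Longrightarrow> deriv A x * deriv g (A x) = 1" "\<And>x. x \<in> ball w \<rho> \<Longrightarrow> g (A x) = x"
    using holomorphic_has_inverse[OF holA\<rho> _ \<rho>(3)] by auto
  have opn: "open (A ` ball w \<rho>)" by (rule open_mapping_thm3[OF holA\<rho> _ \<rho>(3)]) auto
  have "(g has_field_derivative deriv g (A w)) (at (A w))"
    using holomorphic_derivI[OF g(1) opn] \<rho>(1) by auto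
  moreover have "deriv g (A w) = 1 / A' w"
    using g(2)[of w] \<rho>(1) A'w by (simp add: field_simps)
  ultimately have "(g has_field_derivative 1 / A' w) (at (A (\<phi> s z)) within (\<lambda>h. A (\<phi> h z)) ` {0..})"
    by (simp add: w_def has_field_derivative_at_within)
  from field_vector_diff_chain_within[OF derT this]
  have der: "((g \<circ> (\<lambda>h. A (\<phi> h z))) has_vector_derivative (\<phi> d w - w) * (1 / A' w)) (at s within {0..})" .
  have "continuous_on {0..} (\<lambda>h. \<phi> h z)" by (rule SD(6)[OF z])
  then obtain e where e: "e > 0" "\<And>h. h \<ge> 0 \<Longrightarrow> dist h s < e \<Longrightarrow> dist (\<phi> h z) w < \<rho>"
    unfolding continuous_on_iff w_def using s \<rho>(1) by (metis atLeast_iff)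
  have "((\<lambda>h. \<phi> h z) has_vector_derivative (\<phi> d w - w) * (1 / A' w)) (at s within {0..})"
    using der
  proof (rule has_vector_derivative_transform_within)
    fix h assume "h \<in> {0..}" "dist h s < e"
    then have "\<phi> h z \<in> ball w \<rho>" using e(2) by (simp add: dist_commute)
    then show "(g \<circ> (\<lambda>h. A (\<phi> h z))) h = \<phi> h z" using g(3) by simp
  qed (use e s in auto)
  then show ?thesis by (simp add: w_def A'_def)
qed

text \<open>
  The generator is the right derivative of the orbits at time 0. Near each point the time average over
  a short interval expresses it as a quotient of holomorphic functions.
\<close>

lemma semigroup_generator:
  assumes S: "continuous_conformal_semigroup \<phi>"
  obtains G where "G holomorphic_on ball 0 1"
    "\<And>z s. cmod z < 1 \<Longrightarrow> s \<ge> 0 \<Longrightarrow> ((\<lambda>t. \<phi> t z) has_vector_derivative G (\<phi> s z)) (at s within {0..})"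
proof -
  note SD = continuous_conformal_semigroupD[OF S]
  define G where "G z = vector_derivative (\<lambda>t. \<phi> t z) (at 0 within {0..})" for z
  define A' where "A' d z = integral {0..d} (\<lambda>r. deriv (\<phi> r) z)" for d z
  have nbot: "at (0::real) within {0..} \<noteq> bot"
    using at_within_Ici_at_right[of "0::real"] by (simp add: trivial_limit_at_right_real)
  have G: "G w = (\<phi> d w - w) / A' d w" if "cmod w < 1" "d > 0" "A' d w \<noteq> 0" for w d
  proof -
    have "((\<lambda>t. \<phi> t w) has_vector_derivative (\<phi> d w - w) / A' d w) (at 0 within {0..})"
      using semigroup_has_time_derivative[OF S that(1) order_refl that(2)] that SD(4)[OF that(1)]
      by (simp add: A'_def)
    then show ?thesis unfolding G_def using nbot by (intro vector_derivative_within)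
  qed
  have "G field_differentiable at w" if w: "cmod w < 1" for w
  proof -
    obtain d where d: "d > 0" "A' d w \<noteq> 0"
      using semigroup_time_average_deriv_nonzero[OF S w] unfolding A'_def by blast
    define A where "A z = integral {0..d} (\<lambda>r. \<phi> r z)" for z
    have derA: "(A has_field_derivative A' d z) (at z)" if "cmod z < 1" for z
      unfolding A_def A'_def by (rule semigroup_time_average_has_derivative[OF S that])
    have holA: "A holomorphic_on ball 0 1"
      using derA by (auto simp: holomorphic_on_open intro!: exI derA)
    have "deriv A holomorphic_on ball 0 1" by (intro holomorphic_deriv holA) auto
    then have holA': "A' d holomorphic_on ball 0 1"
      by (rule holomorphic_transform) (use derA DERIV_imp_deriv in auto)
    define U where "U = {z \<in> ball 0 1. A' d z \<noteq> 0}"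
    have "open U"
    proof -
      have "open (ball 0 1 \<inter> A' d -` (- {0}))"
        by (intro continuous_open_preimage holomorphic_on_imp_continuous_on[OF holA'])
           (auto intro: open_Compl)
      moreover have "U = ball 0 1 \<inter> A' d -` (- {0})" by (auto simp: U_def)
      ultimately show ?thesis by simp
    qed
    have "(\<lambda>z. (\<phi> d z - z) / A' d z) holomorphic_on U"
      using d by (intro holomorphic_intros holomorphic_on_subset[OF SD(1)[of d]] holomorphic_on_subset[OF holA'])
        (auto simp: U_def)
    then have "G holomorphic_on U"
      by (rule holomorphic_transform) (use G d in \<open>auto simp: U_def\<close>)
    moreover have "w \<in> U" using w d by (simp add: U_def)
    ultimately show ?thesis using \<open>open U\<close> holomorphic_on_imp_differentiable_at by blast
  qed
  then have "G holomorphic_on ball 0 1"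
    by (auto simp: holomorphic_on_def intro: field_differentiable_at_within)
  moreover have "((\<lambda>t. \<phi> t z) has_vector_derivative G (\<phi> s z)) (at s within {0..})"
    if z: "cmod z < 1" and s: "s \<ge> 0" for z s
  proof -
    have w: "cmod (\<phi> s z) < 1" using SD(3) z s by auto
    obtain d where d: "d > 0" "A' d (\<phi> s z) \<noteq> 0"
      using semigroup_time_average_deriv_nonzero[OF S w] unfolding A'_def by blast
    show ?thesis
      using semigroup_has_time_derivative[OF S z s d(1)] d G[OF w d] by (simp add: A'_def)
  qed
  ultimately show thesis by (rule that)
qed

text \<open>
  Differentiate \<open>\<phi>\<^sub>s (\<phi>\<^sub>t z) = \<phi>\<^sub>t (\<phi>\<^sub>s z)\<close> with respect to \<open>s\<close> at 0.
\<close>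

lemma semigroup_generator_commutes:
  assumes S: "continuous_conformal_semigroup \<phi>"
    and G: "\<And>z s. cmod z < 1 \<Longrightarrow> s \<ge> 0 \<Longrightarrow> ((\<lambda>t. \<phi> t z) has_vector_derivative G (\<phi> s z)) (at s within {0..})"
    and z: "cmod z < 1" and t: "t \<ge> 0"
  shows "G (\<phi> t z) = deriv (\<phi> t) z * G z"
proof -
  note SD = continuous_conformal_semigroupD[OF S]
  have tz: "cmod (\<phi> t z) < 1" using SD(3) z t by auto
  have nbot: "at (0::real) within {0..} \<noteq> bot"
    using at_within_Ici_at_right[of "0::real"] by (simp add: trivial_limit_at_right_real)
  have 1: "((\<lambda>s. \<phi> s (\<phi> t z)) has_vector_derivative G (\<phi> t z)) (at 0 within {0..})"
    using G[OF tz order_refl] SD(4)[OF tz] by simp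
  have "(\<phi> t has_field_derivative deriv (\<phi> t) z) (at (\<phi> 0 z) within (\<lambda>s. \<phi> s z) ` {0..})"
    using holomorphic_derivI[OF SD(1)[OF t], of z] z SD(4)[OF z] by (simp add: has_field_derivative_at_within)
  from field_vector_diff_chain_within[OF G[OF z order_refl] this]
  have "((\<lambda>s. \<phi> t (\<phi> s z)) has_vector_derivative G z * deriv (\<phi> t) z) (at 0 within {0..})"
    by (simp add: o_def SD(4)[OF z])
  then have "((\<lambda>s. \<phi> s (\<phi> t z)) has_vector_derivative G z * deriv (\<phi> t) z) (at 0 within {0..})"
  proof (rule has_vector_derivative_transform[rotated 2])
    fix s :: real assume "s \<in> {0..}"
    then show "\<phi> s (\<phi> t z) = \<phi> t (\<phi> s z)"
      using SD(5)[of s t z] SD(5)[of t s z] z t by (simp add: add.commute)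
  qed auto
  with 1 nbot show ?thesis
    by (metis vector_derivative_within mult.commute)
qed

section \<open>A common Wolff point\<close>

text \<open>
  For \<open>\<tau>\<close> on the circle this is invariance of the horodisks at \<open>\<tau>\<close>. For \<open>\<tau>\<close> inside the disk it is
  invariance of the hyperbolic disks around \<open>\<tau>\<close>, which forces \<open>\<tau>\<close> to be a fixed point. The common form
  is closed under limits in \<open>\<tau>\<close> and \<open>f\<close>, so that both cases are found by one compactness argument.
\<close>

definition Julia_at :: "complex \<Rightarrow> (complex \<Rightarrow> complex) \<Rightarrow> bool" where
  "Julia_at \<tau> f \<longleftrightarrow> (\<forall>z. cmod z < 1 \<longrightarrow>
     (cmod (1 - cnj \<tau> * f z))\<^sup>2 * (1 - (cmod z)\<^sup>2) \<le> (cmod (1 - cnj \<tau> * z))\<^sup>2 * (1 - (cmod (f z))\<^sup>2))"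

text \<open>
  Dividing by \<open>\<bar>1 - cnj a * z\<bar>\<^sup>2\<close> turns this into the formula for \<open>1 - \<bar>M z\<bar>\<^sup>2\<close>, where \<open>M\<close> is the
  Moebius transformation of the disk that maps \<open>a\<close> to 0.
\<close>

lemma norm_Moebius_identity:
  "(cmod (z - a))\<^sup>2 = (cmod (1 - cnj a * z))\<^sup>2 - (1 - (cmod a)\<^sup>2) * (1 - (cmod z)\<^sup>2)"
  unfolding cmod_power2 by (simp add: algebra_simps power2_eq_square)

lemma one_minus_cnj_mult_nonzero:
  assumes "cmod a \<le> 1" "cmod z < 1"
  shows "1 - cnj a * z \<noteq> 0"
proof -
  have "cmod (cnj a * z) \<le> 1 * cmod z"
    unfolding norm_mult using assms by (intro mult_right_mono) auto
  then have "cnj a * z \<noteq> 1" using assms(2) by force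
  then show ?thesis by simp
qed

text \<open>
  The Schwarz lemma after moving the fixed point to 0.
\<close>

lemma Julia_at_fixed_point:
  assumes g: "g holomorphic_on ball 0 1" and g1: "\<And>z. cmod z < 1 \<Longrightarrow> cmod (g z) < 1"
    and a: "cmod a < 1" "g a = a"
  shows "Julia_at a g"
  unfolding Julia_at_def
proof (intro allI impI)
  fix z :: complex assume z: "cmod z < 1"
  define M where "M = Moebius_function 0 a"
  define N where "N = Moebius_function 0 (- a)"
  have M1: "cmod (M w) < 1" and N1: "cmod (N w) < 1" and NM: "N (M w) = w" if "cmod w < 1" for w
    using that a(1) Moebius_function_norm_lt_1 Moebius_function_compose[of "-a" a w]
    by (auto simp: M_def N_def)
  have N0: "N 0 = a" and Ma: "M a = 0"
    by (auto simp: N_def M_def Moebius_function_of_zero Moebius_function_eq_zero)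
  have hol: "M holomorphic_on ball 0 1" "N holomorphic_on ball 0 1"
    using a(1) by (auto simp: M_def N_def intro: Moebius_function_holomorphic)
  have "(g \<circ> N) holomorphic_on ball 0 1"
    using N1 by (intro holomorphic_on_compose_gen[OF hol(2) g]) auto
  then have "(M \<circ> (g \<circ> N)) holomorphic_on ball 0 1"
    using N1 g1 by (intro holomorphic_on_compose_gen[OF _ hol(1)]) auto
  from Schwarz_Lemma(1)[OF this, of "M z"]
  have "cmod (M (g z)) \<le> cmod (M z)"
    using M1 N1 g1 z NM N0 Ma a by auto
  moreover have nz: "cmod (1 - cnj a * w) > 0" if "cmod w < 1" for w
    using one_minus_cnj_mult_nonzero[of a w] a(1) that by simp
  moreover note g1[OF z]
  ultimately have "cmod (g z - a) * cmod (1 - cnj a * z) \<le> cmod (z - a) * cmod (1 - cnj a * g z)"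
    using z by (simp add: M_def Moebius_function_simple norm_divide frac_le_eq divide_simps split: if_splits)
  from power_mono[OF this, of 2]
  have "(cmod (g z - a))\<^sup>2 * (cmod (1 - cnj a * z))\<^sup>2 \<le> (cmod (z - a))\<^sup>2 * (cmod (1 - cnj a * g z))\<^sup>2"
    by (simp add: power_mult_distrib)
  then have "(1 - (cmod a)\<^sup>2) * ((cmod (1 - cnj a * g z))\<^sup>2 * (1 - (cmod z)\<^sup>2)) \<le>
     (1 - (cmod a)\<^sup>2) * ((cmod (1 - cnj a * z))\<^sup>2 * (1 - (cmod (g z))\<^sup>2))"
    by (simp only: norm_Moebius_identity[of z a] norm_Moebius_identity[of "g z" a]) (simp add: algebra_simps)
  moreover have "1 - (cmod a)\<^sup>2 > 0" using a(1) by (simp add: power_less_one_iff)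
  ultimately show "(cmod (1 - cnj a * g z))\<^sup>2 * (1 - (cmod z)\<^sup>2) \<le> (cmod (1 - cnj a * z))\<^sup>2 * (1 - (cmod (g z))\<^sup>2)"
    by (simp only: mult_le_cancel_left_pos)
qed

text \<open>
  For \<open>r < 1\<close> the map \<open>r f\<close> sends the closed disk of radius \<open>r\<close> to itself and has a fixed point by
  Brouwer's theorem. A limit of these fixed points as \<open>r\<close> tends to 1 is the desired point.
\<close>

lemma Wolff_point_exists:
  assumes f: "f holomorphic_on ball 0 1" and f1: "\<And>z. cmod z < 1 \<Longrightarrow> cmod (f z) < 1"
  obtains \<tau> where "cmod \<tau> \<le> 1" "Julia_at \<tau> f"
proof -
  define r where "r n = 1 - 1 / (real n + 2)" for n
  have r: "0 < r n" "r n < 1" for n by (auto simp: r_def field_simps)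
  have rlim: "r \<longlonglongrightarrow> 1" unfolding r_def by real_asymp
  have "\<exists>a. cmod a < 1 \<and> of_real (r n) * f a = a" for n
  proof -
    have "\<exists>a\<in>cball 0 (r n). of_real (r n) * f a = a"
    proof (rule brouwer[of "cball 0 (r n)" "\<lambda>z. of_real (r n) * f z"])
      have "cball 0 (r n) \<subseteq> ball (0::complex) 1"
      proof
        fix x :: complex assume "x \<in> cball 0 (r n)"
        then show "x \<in> ball 0 1" using r(2)[of n] by simp
      qed
      then show "continuous_on (cball 0 (r n)) (\<lambda>z. of_real (r n) * f z)"
        by (intro continuous_intros continuous_on_subset[OF holomorphic_on_imp_continuous_on[OF f]])
      have "cmod (of_real (r n) * f z) \<le> r n" if "cmod z \<le> r n" for z
        using f1[of z] that r[of n] by (simp add: norm_mult mult_left_le)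
      then show "(\<lambda>z. of_real (r n) * f z) \<in> cball 0 (r n) \<rightarrow> cball 0 (r n)" by auto
    qed (use r[of n] in auto)
    then show ?thesis using r[of n] by force
  qed
  then obtain a where a: "\<And>n. cmod (a n) < 1" "\<And>n. of_real (r n) * f (a n) = a n" by metis
  have J: "Julia_at (a n) (\<lambda>z. of_real (r n) * f z)" for n
  proof (rule Julia_at_fixed_point)
    show "cmod (of_real (r n) * f z) < 1" if "cmod z < 1" for z
    proof -
      have "r n * cmod (f z) \<le> 1 * cmod (f z)" using r[of n] by (intro mult_right_mono) auto
      then show ?thesis using f1[OF that] r[of n] by (simp add: norm_mult)
    qed
  qed (use a in \<open>auto intro!: holomorphic_intros f\<close>)
  have "compact (cball (0::complex) 1)" by simp
  moreover have "\<forall>n. a n \<in> cball 0 1" using a(1) less_imp_le by auto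
  ultimately obtain \<tau> s where \<tau>: "\<tau> \<in> cball 0 1" "strict_mono (s :: nat \<Rightarrow> nat)" "(a \<circ> s) \<longlonglongrightarrow> \<tau>"
    unfolding compact_def by blast
  have as: "(\<lambda>n. a (s n)) \<longlonglongrightarrow> \<tau>" using \<tau>(3) by (simp add: o_def)
  have rs: "(\<lambda>n. r (s n)) \<longlonglongrightarrow> 1" using LIMSEQ_subseq_LIMSEQ[OF rlim \<tau>(2)] by (simp add: o_def)
  have "Julia_at \<tau> f"
    unfolding Julia_at_def
  proof (intro allI impI)
    fix z :: complex assume z: "cmod z < 1"
    let ?L = "\<lambda>n. (cmod (1 - cnj (a (s n)) * (of_real (r (s n)) * f z)))\<^sup>2 * (1 - (cmod z)\<^sup>2)"
    let ?R = "\<lambda>n. (cmod (1 - cnj (a (s n)) * z))\<^sup>2 * (1 - (cmod (of_real (r (s n)) * f z))\<^sup>2)"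
    have "?L \<longlonglongrightarrow> (cmod (1 - cnj \<tau> * (of_real 1 * f z)))\<^sup>2 * (1 - (cmod z)\<^sup>2)"
      by (intro tendsto_intros as rs)
    moreover have "?R \<longlonglongrightarrow> (cmod (1 - cnj \<tau> * z))\<^sup>2 * (1 - (cmod (of_real 1 * f z))\<^sup>2)"
      by (intro tendsto_intros as rs)
    moreover have "?L n \<le> ?R n" for n using J[of "s n"] z unfolding Julia_at_def by blast
    ultimately have "(cmod (1 - cnj \<tau> * (of_real 1 * f z)))\<^sup>2 * (1 - (cmod z)\<^sup>2) \<le>
        (cmod (1 - cnj \<tau> * z))\<^sup>2 * (1 - (cmod (of_real 1 * f z))\<^sup>2)"
      by (intro LIMSEQ_le[of ?L _ ?R]) auto
    then show "(cmod (1 - cnj \<tau> * f z))\<^sup>2 * (1 - (cmod z)\<^sup>2) \<le> (cmod (1 - cnj \<tau> * z))\<^sup>2 * (1 - (cmod (f z))\<^sup>2)"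
      by simp
  qed
  then show thesis using \<tau>(1) that by auto
qed

lemma Julia_at_compose:
  assumes f: "Julia_at \<tau> f" and g: "Julia_at \<tau> g" and \<tau>: "cmod \<tau> \<le> 1"
    and g1: "\<And>z. cmod z < 1 \<Longrightarrow> cmod (g z) < 1"
    and h: "\<And>z. cmod z < 1 \<Longrightarrow> h z = f (g z)"
  shows "Julia_at \<tau> h"
  unfolding Julia_at_def
proof (intro allI impI)
  fix z :: complex assume z: "cmod z < 1"
  define A B C where "A = (cmod (1 - cnj \<tau> * z))\<^sup>2" and "B = (cmod (1 - cnj \<tau> * g z))\<^sup>2"
    and "C = (cmod (1 - cnj \<tau> * f (g z)))\<^sup>2"
  define x y u where "x = 1 - (cmod z)\<^sup>2" and "y = 1 - (cmod (g z))\<^sup>2" and "u = 1 - (cmod (f (g z)))\<^sup>2"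
  have "B > 0" using one_minus_cnj_mult_nonzero[OF \<tau> g1[OF z]] by (simp add: B_def)
  have "y > 0" "x > 0" using g1[OF z] z by (auto simp: y_def x_def power_less_one_iff)
  have 1: "B * x \<le> A * y" using g z by (simp add: Julia_at_def A_def B_def x_def y_def)
  have 2: "C * y \<le> B * u" using f g1[OF z] by (simp add: Julia_at_def C_def B_def u_def y_def)
  have "(C * x) * (B * y) = (B * x) * (C * y)" by simp
  also have "\<dots> \<le> (A * y) * (B * u)"
    using \<open>B > 0\<close> \<open>x > 0\<close> \<open>y > 0\<close> by (intro mult_mono[OF 1 2]) (auto simp: A_def C_def)
  also have "\<dots> = (A * u) * (B * y)" by simp
  finally have "C * x \<le> A * u" using \<open>B > 0\<close> \<open>y > 0\<close> by (simp add: mult_le_cancel_right_pos)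
  then show "(cmod (1 - cnj \<tau> * h z))\<^sup>2 * (1 - (cmod z)\<^sup>2) \<le> (cmod (1 - cnj \<tau> * z))\<^sup>2 * (1 - (cmod (h z))\<^sup>2)"
    using h[OF z] by (simp add: A_def C_def x_def u_def)
qed

text \<open>
  The admissible points for \<open>\<phi>\<^sub>h\<close> with \<open>h = 2\<^sup>-\<^sup>n\<close> form nonempty compact sets, and they decrease with \<open>n\<close>
  since \<open>\<phi>\<^sub>2\<^sub>h = \<phi>\<^sub>h \<circ> \<phi>\<^sub>h\<close>. A point in all of them serves every dyadic time, and by
  continuity every time.
\<close>

lemma semigroup_Wolff_point:
  assumes S: "continuous_conformal_semigroup \<phi>"
  obtains \<tau> where "cmod \<tau> \<le> 1" "\<And>t. t \<ge> 0 \<Longrightarrow> Julia_at \<tau> (\<phi> t)"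
proof -
  note SD = continuous_conformal_semigroupD[OF S]
  define T where "T n = {\<tau>. cmod \<tau> \<le> 1 \<and> Julia_at \<tau> (\<phi> ((1/2) ^ n))}" for n
  have "\<Inter>(range T) \<noteq> {}"
  proof (rule compact_nest)
    show "compact (T n)" for n
    proof -
      have "T n = cball 0 1 \<inter> {\<tau>. Julia_at \<tau> (\<phi> ((1/2) ^ n))}" by (auto simp: T_def)
      moreover have "closed {\<tau>. Julia_at \<tau> (\<phi> ((1/2) ^ n))}"
        unfolding Julia_at_def
        by (intro closed_Collect_all closed_Collect_imp open_Collect_const closed_Collect_le continuous_intros)
      ultimately show ?thesis by auto
    qed
    show "T n \<noteq> {}" for n
    proof -
      have n: "(1/2::real) ^ n \<ge> 0" by simp
      obtain \<tau> where "cmod \<tau> \<le> 1" "Julia_at \<tau> (\<phi> ((1/2) ^ n))"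
        by (rule Wolff_point_exists[OF SD(1)[OF n] SD(3)[OF n]])
      then show ?thesis by (auto simp: T_def)
    qed
    show "T n \<subseteq> T m" if "m \<le> n" for m n
    proof (rule lift_Suc_antimono_le[OF _ that])
      fix k
      have k: "(1/2::real) ^ Suc k \<ge> 0" by simp
      show "T (Suc k) \<subseteq> T k"
      proof
        fix \<tau> assume "\<tau> \<in> T (Suc k)"
        then have \<tau>: "cmod \<tau> \<le> 1" "Julia_at \<tau> (\<phi> ((1/2) ^ Suc k))" by (auto simp: T_def)
        have "Julia_at \<tau> (\<phi> ((1/2) ^ k))"
        proof (rule Julia_at_compose[OF \<tau>(2) \<tau>(2) \<tau>(1) SD(3)[OF k]])
          show "\<phi> ((1/2) ^ k) z = \<phi> ((1/2) ^ Suc k) (\<phi> ((1/2) ^ Suc k) z)" if "cmod z < 1" for z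
            using SD(5)[OF k k that] by simp
        qed
        then show "\<tau> \<in> T k" using \<tau>(1) by (simp add: T_def)
      qed
    qed
  qed
  then obtain \<tau> where "\<And>n. \<tau> \<in> T n" by blast
  then have \<tau>: "cmod \<tau> \<le> 1" "\<And>n. Julia_at \<tau> (\<phi> ((1/2) ^ n))" by (auto simp: T_def)
  have dyadic: "Julia_at \<tau> (\<phi> (real k * (1/2) ^ n))" for k n
  proof (induction k)
    case 0
    then show ?case using SD(4) by (simp add: Julia_at_def)
  next
    case (Suc k)
    show ?case
    proof (rule Julia_at_compose[OF \<tau>(2)[of n] Suc \<tau>(1)])
      have "real k * (1/2) ^ n \<ge> 0" "(1/2::real) ^ n \<ge> 0" by auto
      note nn = this
      show "cmod (\<phi> (real k * (1/2) ^ n) z) < 1" if "cmod z < 1" for z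
        using SD(3)[OF nn(1) that] .
      show "\<phi> (real (Suc k) * (1/2) ^ n) z = \<phi> ((1/2) ^ n) (\<phi> (real k * (1/2) ^ n) z)" if "cmod z < 1" for z
        using SD(5)[OF nn that] by (simp add: algebra_simps)
    qed
  qed
  have "Julia_at \<tau> (\<phi> t)" if t: "t \<ge> 0" for t
    unfolding Julia_at_def
  proof (intro allI impI)
    fix z :: complex assume z: "cmod z < 1"
    define s where "s n = real (nat \<lfloor>t * 2 ^ n\<rfloor>) * (1/2) ^ n" for n
    have s: "s n = of_int \<lfloor>t * 2 ^ n\<rfloor> * (1/2) ^ n" for n using t by (simp add: s_def)
    have s0: "s n \<ge> 0" for n by (simp add: s_def)
    have slim: "s \<longlonglongrightarrow> t"
    proof (rule tendsto_sandwich[of "\<lambda>n. t - (1/2) ^ n" s sequentially "\<lambda>n. t"])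
      have b: "t - (1/2) ^ n \<le> s n \<and> s n \<le> t" for n
      proof -
        have e: "(t * 2 ^ n) * (1/2) ^ n = t" "(t * 2 ^ n - 1) * (1/2) ^ n = t - (1/2) ^ n"
          by (simp_all add: left_diff_distrib diff_divide_distrib power_divide)
        have le: "of_int \<lfloor>t * 2 ^ n\<rfloor> * (1/2) ^ n \<le> (t * 2 ^ n) * (1/2) ^ n"
          by (intro mult_right_mono) auto
        have ge: "(t * 2 ^ n - 1) * (1/2) ^ n \<le> of_int \<lfloor>t * 2 ^ n\<rfloor> * (1/2) ^ n"
          by (rule mult_right_mono) (linarith | simp)+
        show ?thesis unfolding s using le[unfolded e] ge[unfolded e] by blast
      qed
      then show "\<forall>\<^sub>F n in sequentially. t - (1/2) ^ n \<le> s n" "\<forall>\<^sub>F n in sequentially. s n \<le> t" by auto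
      show "(\<lambda>n. t - (1/2) ^ n) \<longlonglongrightarrow> t"
        using tendsto_diff[OF tendsto_const LIMSEQ_power_zero[of "1/2::real"], of t] by simp
    qed auto
    have lim: "(\<lambda>n. \<phi> (s n) z) \<longlonglongrightarrow> \<phi> t z"
      using continuous_on_tendsto_compose[OF SD(6)[OF z] slim] t s0 by auto
    let ?L = "\<lambda>n. (cmod (1 - cnj \<tau> * \<phi> (s n) z))\<^sup>2 * (1 - (cmod z)\<^sup>2)"
    let ?R = "\<lambda>n. (cmod (1 - cnj \<tau> * z))\<^sup>2 * (1 - (cmod (\<phi> (s n) z))\<^sup>2)"
    have "?L \<longlonglongrightarrow> (cmod (1 - cnj \<tau> * \<phi> t z))\<^sup>2 * (1 - (cmod z)\<^sup>2)"
      by (intro tendsto_intros lim)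
    moreover have "?R \<longlonglongrightarrow> (cmod (1 - cnj \<tau> * z))\<^sup>2 * (1 - (cmod (\<phi> t z))\<^sup>2)"
      by (intro tendsto_intros lim)
    moreover have "?L n \<le> ?R n" for n
      using dyadic[of "nat \<lfloor>t * 2 ^ n\<rfloor>" n] z unfolding Julia_at_def s_def by blast
    ultimately show "(cmod (1 - cnj \<tau> * \<phi> t z))\<^sup>2 * (1 - (cmod z)\<^sup>2) \<le>
        (cmod (1 - cnj \<tau> * z))\<^sup>2 * (1 - (cmod (\<phi> t z))\<^sup>2)"
      by (intro LIMSEQ_le[of ?L _ ?R]) auto
  qed
  then show thesis using \<tau>(1) that by blast
qed

lemma Julia_at_interior_imp_fixed:
  assumes J: "Julia_at \<tau> f" and \<tau>: "cmod \<tau> < 1" and f1: "cmod (f \<tau>) < 1"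
  shows "f \<tau> = \<tau>"
proof -
  define q where "q = 1 - (cmod \<tau>)\<^sup>2"
  have q: "q > 0" using \<tau> by (simp add: q_def power_less_one_iff)
  have "cnj \<tau> * \<tau> = of_real ((cmod \<tau>)\<^sup>2)"
    by (metis complex_norm_square mult.commute)
  then have "1 - cnj \<tau> * \<tau> = of_real q" by (simp add: q_def)
  then have "cmod (1 - cnj \<tau> * \<tau>) = q" using q by simp
  moreover have "(cmod (1 - cnj \<tau> * f \<tau>))\<^sup>2 * q \<le> (cmod (1 - cnj \<tau> * \<tau>))\<^sup>2 * (1 - (cmod (f \<tau>))\<^sup>2)"
    using J \<tau> unfolding Julia_at_def q_def by blast
  ultimately have "(cmod (1 - cnj \<tau> * f \<tau>))\<^sup>2 * q \<le> (q * (1 - (cmod (f \<tau>))\<^sup>2)) * q"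
    by (simp add: power2_eq_square algebra_simps)
  then have "(cmod (1 - cnj \<tau> * f \<tau>))\<^sup>2 \<le> q * (1 - (cmod (f \<tau>))\<^sup>2)"
    using q by (simp only: mult_le_cancel_right_pos)
  then have "(cmod (f \<tau> - \<tau>))\<^sup>2 \<le> 0"
    by (simp only: norm_Moebius_identity[of "f \<tau>" \<tau>] q_def)
  then show ?thesis by simp
qed

section \<open>Derivative majorants and monotonicity along orbits\<close>

text \<open>
  The key estimate as a property of a single map: \<open>1 / \<bar>f'\<bar>\<^sup>2\<close> is at most \<open>C \<bar>P\<bar> / (1 - \<bar>z\<bar>)\<close>.
  Written without division, it also says that neither \<open>P\<close> nor the derivative vanishes.
\<close>

definition inverse_derivative_majorant :: "(complex \<Rightarrow> complex) \<Rightarrow> bool" where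
  "inverse_derivative_majorant f \<longleftrightarrow> (\<exists>P C. P holomorphic_on ball 0 1 \<and> (\<forall>z. cmod z < 1 \<longrightarrow> Re (P z) \<ge> 0) \<and>
     C > 0 \<and> (\<forall>z. cmod z < 1 \<longrightarrow> 1 - cmod z \<le> C * cmod (P z) * (cmod (deriv f z))\<^sup>2))"

lemma half_line_deriv_nonneg_imp_le:
  fixes f :: "real \<Rightarrow> real"
  assumes der: "\<And>s. 0 \<le> s \<Longrightarrow> s \<le> t \<Longrightarrow> (f has_real_derivative f' s) (at s within {0..})"
    and nn: "\<And>s. 0 \<le> s \<Longrightarrow> s \<le> t \<Longrightarrow> f' s \<ge> 0" and t: "t \<ge> 0"
  shows "f 0 \<le> f t"
proof (rule DERIV_nonneg_imp_increasing_open[OF t])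
  fix s assume s: "0 < s" "s < t"
  have "at s within {0..} = at s" using s by (intro at_within_interior) (simp add: interior_real_atLeast)
  then show "\<exists>y. (f has_real_derivative y) (at s) \<and> 0 \<le> y"
    using der[of s] nn[of s] s by (intro exI[of _ "f' s"]) auto
next
  show "continuous_on {0..t} f"
    unfolding continuous_on_eq_continuous_within
  proof
    fix s assume "s \<in> {0..t}"
    then show "continuous (at s within {0..t}) f"
      using continuous_within_subset[OF DERIV_continuous[OF der[of s]], of "{0..t}"] by auto
  qed
qed

lemma half_line_increasing_imp_deriv_nonneg:
  fixes f :: "real \<Rightarrow> real"
  assumes "(f has_real_derivative D) (at 0 within {0..})" "\<And>s. s \<ge> 0 \<Longrightarrow> f 0 \<le> f s"
  shows "D \<ge> 0"
proof (rule tendsto_lowerbound)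
  show "((\<lambda>y. (f y - f 0) / (y - 0)) \<longlongrightarrow> D) (at 0 within {0..})"
    using assms(1) by (simp add: has_field_derivative_iff)
  show "\<forall>\<^sub>F y in at 0 within {0..}. 0 \<le> (f y - f 0) / (y - 0)"
    using assms(2) by (auto simp: eventually_at_filter)
  show "at (0::real) within {0..} \<noteq> bot"
    using at_within_Ici_at_right[of "0::real"] by (simp add: trivial_limit_at_right_real)
qed

lemma has_real_derivative_norm_squared:
  fixes y :: "real \<Rightarrow> complex"
  assumes "(y has_vector_derivative y') (at s within S)"
  shows "((\<lambda>s. (cmod (y s))\<^sup>2) has_real_derivative 2 * Re (cnj (y s) * y')) (at s within S)"
proof -
  have "((\<lambda>s. y s \<bullet> y s) has_derivative (\<lambda>h. y s \<bullet> (h *\<^sub>R y') + (h *\<^sub>R y') \<bullet> y s)) (at s within S)"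
    using assms unfolding has_vector_derivative_def by (intro derivative_intros)
  then have "((\<lambda>s. (cmod (y s))\<^sup>2) has_derivative (\<lambda>h. (2 * Re (cnj (y s) * y')) * h)) (at s within S)"
    by (simp add: power2_norm_eq_inner inner_commute inner_complex_def algebra_simps)
  then show ?thesis by (simp add: has_field_derivative_def)
qed

text \<open>
  A differential inequality: the hypothesis says that the logarithmic derivative of \<open>x\<close> dominates that of
  \<open>\<bar>y\<bar>\<close> in absolute value. It is applied with \<open>y\<close> the generator factor along an orbit and \<open>x\<close> the
  distance to the boundary in suitable coordinates.
\<close>

lemma norm_times_weight_increasing:
  fixes y :: "real \<Rightarrow> complex" and x :: "real \<Rightarrow> real"
  assumes y: "\<And>s. 0 \<le> s \<Longrightarrow> s \<le> t \<Longrightarrow> (y has_vector_derivative y' s) (at s within {0..})"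
    and x: "\<And>s. 0 \<le> s \<Longrightarrow> s \<le> t \<Longrightarrow> (x has_real_derivative x' s) (at s within {0..})"
    and x0: "\<And>s. 0 \<le> s \<Longrightarrow> s \<le> t \<Longrightarrow> x s \<ge> 0"
    and le: "\<And>s. 0 \<le> s \<Longrightarrow> s \<le> t \<Longrightarrow> cmod (y' s) * x s \<le> cmod (y s) * x' s"
    and t: "t \<ge> 0"
  shows "cmod (y 0) * x 0 \<le> cmod (y t) * x t"
proof -
  have "(cmod (y 0))\<^sup>2 * (x 0)\<^sup>2 \<le> (cmod (y t))\<^sup>2 * (x t)\<^sup>2"
  proof (rule half_line_deriv_nonneg_imp_le[OF _ _ t])
    fix s assume s: "0 \<le> s" "s \<le> t"
    show "((\<lambda>s. (cmod (y s))\<^sup>2 * (x s)\<^sup>2) has_real_derivative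
      (2 * Re (cnj (y s) * y' s)) * (x s)\<^sup>2 + (2 * x s * x' s) * (cmod (y s))\<^sup>2) (at s within {0..})"
    proof (rule DERIV_mult[OF has_real_derivative_norm_squared[OF y[OF s]]])
      show "((\<lambda>s. (x s)\<^sup>2) has_real_derivative 2 * x s * x' s) (at s within {0..})"
        using x[OF s] by (auto intro!: derivative_eq_intros)
    qed
    have "- Re (cnj (y s) * y' s) \<le> cmod (y s) * cmod (y' s)"
      using abs_Re_le_cmod[of "cnj (y s) * y' s"] by (simp add: norm_mult)
    then have "- Re (cnj (y s) * y' s) * (x s)\<^sup>2 \<le> cmod (y s) * cmod (y' s) * (x s)\<^sup>2"
      by (rule mult_right_mono) simp
    also have "\<dots> = (cmod (y s) * x s) * (cmod (y' s) * x s)"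
      by (simp add: power2_eq_square)
    also have "\<dots> \<le> (cmod (y s) * x s) * (cmod (y s) * x' s)"
      using x0[OF s] by (intro mult_left_mono le s) auto
    finally show "0 \<le> (2 * Re (cnj (y s) * y' s)) * (x s)\<^sup>2 + (2 * x s * x' s) * (cmod (y s))\<^sup>2"
      by (simp add: power2_eq_square algebra_simps)
  qed
  then have "(cmod (y 0) * x 0)\<^sup>2 \<le> (cmod (y t) * x t)\<^sup>2" by (simp add: power_mult_distrib)
  then show ?thesis
    by (rule power2_le_imp_le) (use x0[of t] t in auto)
qed

text \<open>
  With zero generator every map of the semigroup is the identity on the disk. This case is separate because
  the factor \<open>P\<close> of the generator, which otherwise serves as the majorant, is then 0.
\<close>

lemma inverse_derivative_majorant_trivial_generator:
  assumes S: "continuous_conformal_semigroup \<phi>" and t: "t \<ge> 0"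
    and G: "\<And>z s. cmod z < 1 \<Longrightarrow> s \<ge> 0 \<Longrightarrow> ((\<lambda>t. \<phi> t z) has_vector_derivative G (\<phi> s z)) (at s within {0..})"
    and G0: "\<And>z. cmod z < 1 \<Longrightarrow> G z = 0"
  shows "inverse_derivative_majorant (\<phi> t)"
proof -
  note SD = continuous_conformal_semigroupD[OF S]
  have id: "\<phi> t z = z" if z: "cmod z < 1" for z
  proof -
    have "((\<lambda>t. \<phi> t z) has_vector_derivative 0) (at s within {0..})" if "s \<in> {0..}" for s
      using G[OF z, of s] G0[OF SD(3)[OF _ z], of s] that by simp
    then obtain c where "\<And>s. s \<in> {0..} \<Longrightarrow> \<phi> s z = c"
      using has_vector_derivative_zero_constant[of "{0..}" "\<lambda>t. \<phi> t z"] by blast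
    then show ?thesis using t SD(4)[OF z] by (metis atLeast_iff order_refl)
  qed
  have "deriv (\<phi> t) z = 1" if z: "cmod z < 1" for z
  proof (rule DERIV_imp_deriv)
    show "(\<phi> t has_field_derivative 1) (at z)"
    proof (rule has_field_derivative_transform_within_open[where f = "\<lambda>z. z" and S = "ball 0 1"])
    qed (use z id in \<open>auto intro!: derivative_eq_intros\<close>)
  qed
  then show ?thesis
    unfolding inverse_derivative_majorant_def
    by (intro exI[of _ "\<lambda>z. 1"] exI[of _ 1]) auto
qed

section \<open>Semigroups fixing the origin\<close>

text \<open>
  The computation behind the key estimate when the origin is fixed, with \<open>a = \<bar>\<phi>\<^sub>t z\<bar>\<close>,
  \<open>b = \<bar>z\<bar>\<close>, \<open>D = \<bar>\<phi>\<^sub>t' z\<bar>\<close>, \<open>v = \<bar>P z\<bar>\<close> and \<open>w = \<bar>P (\<phi>\<^sub>t z)\<bar>\<close>. Replacing \<open>1 - a\<close> in the monotonicity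
  bound by \<open>w / c\<close> produces \<open>w\<^sup>2\<close>, and hence \<open>D\<^sup>2\<close>.
\<close>

lemma elliptic_flow_derivative_bound:
  fixes a b c D v w :: real
  assumes a: "0 < a" "a < 1" and b: "0 < b" "b < 1" and c: "c > 0" and p: "v > 0" "w \<ge> 0"
    and eq: "a * w = D * b * v" and mono: "v * (- ln b) \<le> w * (- ln a)"
    and low: "c * (1 - a) \<le> w"
  shows "1 - b \<le> (1 / (c * a ^ 3)) * v * D\<^sup>2"
proof -
  have "1 - b \<le> - ln b" using ln_le_minus_one[OF b(1)] by simp
  moreover have "- ln a \<le> (1 - a) / a"
    using ln_le_minus_one[of "1 / a"] a by (simp add: ln_div field_simps)
  ultimately have "v * (1 - b) \<le> w * ((1 - a) / a)"
    using mono p by (meson mult_left_mono less_imp_le order_trans)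
  also have "\<dots> = (c * (1 - a)) * w / (c * a)" using c by simp
  also have "\<dots> \<le> w * w / (c * a)"
    using low p a c by (intro divide_right_mono mult_right_mono) auto
  also have "w = D * b * v / a" using eq a by (simp add: field_simps)
  also have "(D * b * v / a) * (D * b * v / a) / (c * a) = v * (b\<^sup>2 * ((1 / (c * a ^ 3)) * v * D\<^sup>2))"
    using a c by (simp add: power2_eq_square power3_eq_cube field_simps)
  finally have "1 - b \<le> b\<^sup>2 * ((1 / (c * a ^ 3)) * v * D\<^sup>2)"
    using p(1) by (simp only: mult_le_cancel_left_pos)
  also have "\<dots> \<le> 1 * ((1 / (c * a ^ 3)) * v * D\<^sup>2)"
    using a b c p by (intro mult_right_mono) (auto simp: power_le_one)
  finally show ?thesis by simp
qed

text \<open>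
  The Schwarz lemma makes \<open>\<bar>\<phi>\<^sub>s z\<bar>\<close> decrease with \<open>s\<close>, which gives \<open>Re P \<ge> 0\<close> for \<open>G z = - z P z\<close>. The
  bound obtained from the flow degenerates where \<open>\<phi>\<^sub>t z\<close> is close to 0. By injectivity \<open>\<phi>\<^sub>t z\<close> stays away from 0
  when \<open>\<bar>z\<bar> \<ge> 1/2\<close>, and for \<open>\<bar>z\<bar> \<le> 1/2\<close> compactness suffices.
\<close>

lemma elliptic_inverse_derivative_majorant:
  assumes S: "continuous_conformal_semigroup \<phi>" and fix0: "\<And>t. t \<ge> 0 \<Longrightarrow> \<phi> t 0 = 0" and t: "t \<ge> 0"
  shows "inverse_derivative_majorant (\<phi> t)"
proof -
  note SD = continuous_conformal_semigroupD[OF S]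
  obtain G where hG: "G holomorphic_on ball 0 1"
    and G: "\<And>z s. cmod z < 1 \<Longrightarrow> s \<ge> 0 \<Longrightarrow> ((\<lambda>t. \<phi> t z) has_vector_derivative G (\<phi> s z)) (at s within {0..})"
    using semigroup_generator[OF S] by blast
  have nbot: "at (0::real) within {0..} \<noteq> bot"
    using at_within_Ici_at_right[of "0::real"] by (simp add: trivial_limit_at_right_real)
  have G0: "G 0 = 0"
  proof -
    have 1: "((\<lambda>t. \<phi> t 0) has_vector_derivative G 0) (at 0 within {0..})"
      using G[of 0 0] fix0 by simp
    have "((\<lambda>t. \<phi> t 0) has_vector_derivative 0) (at 0 within {0..})"
      by (rule has_vector_derivative_transform[where f = "\<lambda>t. 0"]) (use fix0 in auto)
    with 1 nbot show ?thesis by (metis vector_derivative_within)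
  qed
  define P where "P z = - (if z = 0 then deriv G 0 else (G z - G 0) / (z - 0))" for z
  have hP: "P holomorphic_on ball 0 1"
    unfolding P_def by (intro holomorphic_intros pole_lemma hG) auto
  have GP: "G z = - z * P z" for z by (simp add: P_def G0)
  have norm_der: "((\<lambda>s. (cmod (\<phi> s z))\<^sup>2) has_real_derivative - 2 * ((cmod (\<phi> s z))\<^sup>2 * Re (P (\<phi> s z)))) (at s within {0..})"
    if z: "cmod z < 1" and s: "s \<ge> 0" for z s
  proof -
    have "2 * Re (cnj (\<phi> s z) * G (\<phi> s z)) = - 2 * ((cmod (\<phi> s z))\<^sup>2 * Re (P (\<phi> s z)))"
      unfolding GP cmod_power2 by (simp add: algebra_simps power2_eq_square)
    then show ?thesis using has_real_derivative_norm_squared[OF G[OF z s]] by simp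
  qed
  have ReP': "Re (P z) \<ge> 0" if z: "cmod z < 1" "z \<noteq> 0" for z
  proof -
    have "((\<lambda>s. - (cmod (\<phi> s z))\<^sup>2) has_real_derivative - (- 2 * ((cmod (\<phi> 0 z))\<^sup>2 * Re (P (\<phi> 0 z))))) (at 0 within {0..})"
      by (intro derivative_intros norm_der z) auto
    then have "0 \<le> - (- 2 * ((cmod (\<phi> 0 z))\<^sup>2 * Re (P (\<phi> 0 z))))"
    proof (rule half_line_increasing_imp_deriv_nonneg)
      fix s :: real assume s: "s \<ge> 0"
      have "cmod (\<phi> s z) \<le> cmod z"
        using Schwarz_Lemma(1)[OF SD(1)[OF s] fix0[OF s] SD(3)[OF s] z(1)] by simp
      then show "- (cmod (\<phi> 0 z))\<^sup>2 \<le> - (cmod (\<phi> s z))\<^sup>2"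
        using SD(4)[OF z(1)] by simp
    qed
    then show ?thesis using SD(4)[OF z(1)] z(2) by (simp add: zero_le_mult_iff)
  qed
  have ReP: "Re (P z) \<ge> 0" if z: "cmod z < 1" for z
  proof (cases "z = 0")
    case True
    have "continuous (at 0) P"
      using holomorphic_on_imp_continuous_on[OF hP] by (simp add: continuous_on_eq_continuous_at)
    then have "((\<lambda>z. Re (P z)) \<longlongrightarrow> Re (P 0)) (at 0)"
      by (intro tendsto_intros) (simp add: continuous_at)
    moreover have "\<forall>\<^sub>F z in at 0. 0 \<le> Re (P z)"
      unfolding eventually_at using ReP' by (intro exI[of _ 1]) auto
    ultimately show ?thesis using True by (intro tendsto_lowerbound[of _ _ "at 0"]) auto
  qed (use ReP' z in auto)
  show ?thesis
  proof (cases "\<exists>a. cmod a < 1 \<and> P a \<noteq> 0")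
    case False
    then have "G z = 0" if "cmod z < 1" for z using that by (auto simp: GP)
    with inverse_derivative_majorant_trivial_generator[OF S t G] show ?thesis by blast
  next
    case True
    then obtain c where c: "c > 0" "\<And>z. cmod z < 1 \<Longrightarrow> c * (1 - cmod z) \<le> cmod (P z)"
      using Re_nonneg_disk_lower_bound[OF hP ReP] by metis
    have Pnz: "cmod (P z) > 0" if "cmod z < 1" for z
    proof -
      have "0 < c * (1 - cmod z)" using c(1) that by simp
      then show ?thesis using c(2)[OF that] by linarith
    qed
    have nz: "\<phi> s z \<noteq> 0" if "s \<ge> 0" "cmod z < 1" "z \<noteq> 0" for s z
      using inj_onD[OF SD(2)[OF that(1)], of z 0] fix0[OF that(1)] that by auto
    have core: "1 - cmod z \<le> (1 / (c * cmod (\<phi> t z) ^ 3)) * cmod (P z) * (cmod (deriv (\<phi> t) z))\<^sup>2"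
      if z: "cmod z < 1" "z \<noteq> 0" for z
    proof (rule elliptic_flow_derivative_bound[where w = "cmod (P (\<phi> t z))"])
      have \<phi>1: "cmod (\<phi> s z) < 1" if "s \<ge> 0" for s using SD(3)[OF that z(1)] .
      show "0 < cmod (\<phi> t z)" "cmod (\<phi> t z) < 1" using nz[OF t z] \<phi>1[OF t] by auto
      show "0 < cmod z" "cmod z < 1" using z by auto
      show "cmod (\<phi> t z) * cmod (P (\<phi> t z)) = cmod (deriv (\<phi> t) z) * cmod z * cmod (P z)"
        using arg_cong[OF semigroup_generator_commutes[OF S G z(1) t], of cmod]
        by (simp add: GP norm_mult)
      show "c * (1 - cmod (\<phi> t z)) \<le> cmod (P (\<phi> t z))" using c(2) \<phi>1[OF t] by blast
      have "cmod (P (\<phi> 0 z)) * (- (1/2) * ln ((cmod (\<phi> 0 z))\<^sup>2)) \<le> cmod (P (\<phi> t z)) * (- (1/2) * ln ((cmod (\<phi> t z))\<^sup>2))"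
      proof (rule norm_times_weight_increasing[OF _ _ _ _ t])
        fix s assume s: "0 \<le> s" "s \<le> t"
        let ?w = "\<phi> s z"
        have w: "cmod ?w < 1" "?w \<noteq> 0" using \<phi>1 nz z s by auto
        have half: "- (1/2) * ln ((cmod ?w)\<^sup>2) = - ln (cmod ?w)"
          using w by (simp add: ln_realpow)
        show "0 \<le> - (1/2) * ln ((cmod ?w)\<^sup>2)" unfolding half using w by simp
        have "(P has_field_derivative deriv P ?w) (at ?w within (\<lambda>s. \<phi> s z) ` {0..})"
          using holomorphic_derivI[OF hP, of ?w] w by (simp add: has_field_derivative_at_within)
        from field_vector_diff_chain_within[OF G[OF z(1) s(1)] this]
        show "((\<lambda>s. P (\<phi> s z)) has_vector_derivative G ?w * deriv P ?w) (at s within {0..})"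
          by (simp add: o_def)
        have "((\<lambda>s. - (1/2) * ln ((cmod (\<phi> s z))\<^sup>2)) has_real_derivative
           - (1/2) * (1 / (cmod ?w)\<^sup>2 * (- 2 * ((cmod ?w)\<^sup>2 * Re (P ?w))))) (at s within {0..})"
          using w by (intro DERIV_cmult DERIV_chain2[OF DERIV_ln_divide] norm_der z s) auto
        then show "((\<lambda>s. - (1/2) * ln ((cmod (\<phi> s z))\<^sup>2)) has_real_derivative Re (P ?w)) (at s within {0..})"
          using w by simp
        have "cmod (deriv P ?w) * cmod ?w * (- ln (cmod ?w)) \<le> Re (P ?w)"
          by (rule disk_log_deriv_le[OF hP ReP w])
        then have "cmod (P ?w) * (cmod (deriv P ?w) * cmod ?w * (- ln (cmod ?w))) \<le> cmod (P ?w) * Re (P ?w)"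
          by (rule mult_left_mono) simp
        then show "cmod (G ?w * deriv P ?w) * (- (1/2) * ln ((cmod ?w)\<^sup>2)) \<le> cmod (P ?w) * Re (P ?w)"
          unfolding half by (simp add: GP norm_mult mult_ac)
      qed
      then show "cmod (P z) * (- ln (cmod z)) \<le> cmod (P (\<phi> t z)) * (- ln (cmod (\<phi> t z)))"
        using z nz[OF t z] SD(4)[OF z(1)] by (simp add: ln_realpow)
    qed (use c z Pnz in auto)
    (* A neighbourhood of 0 is already covered by the images of points with modulus below 1/2. *)
    have "open (\<phi> t ` ball 0 (1/2))"
      by (intro open_mapping_thm3 holomorphic_on_subset[OF SD(1)[OF t]] inj_on_subset[OF SD(2)[OF t]]) auto
    moreover have "0 \<in> \<phi> t ` ball 0 (1/2)" using fix0[OF t] by force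
    ultimately obtain e where e: "e > 0" "ball 0 e \<subseteq> \<phi> t ` ball 0 (1/2)"
      using open_contains_ball by blast
    have far: "e \<le> cmod (\<phi> t z)" if z: "cmod z < 1" "1/2 \<le> cmod z" for z
    proof (rule ccontr)
      assume "\<not> e \<le> cmod (\<phi> t z)"
      then have "\<phi> t z \<in> \<phi> t ` ball 0 (1/2)" using e(2) by auto
      then obtain z' where "cmod z' < 1/2" "\<phi> t z' = \<phi> t z" by force
      then have "z' = z" using inj_onD[OF SD(2)[OF t], of z' z] z(1) by simp
      then show False using \<open>cmod z' < 1/2\<close> z(2) by simp
    qed
    have "continuous_on (cball 0 (1/2)) (deriv (\<phi> t))"
      by (rule continuous_on_subset[OF holomorphic_on_imp_continuous_on[OF holomorphic_deriv[OF SD(1)[OF t]]]]) auto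
    then have "\<exists>x\<in>cball 0 (1/2). \<forall>y\<in>cball 0 (1/2). cmod (deriv (\<phi> t) x) \<le> cmod (deriv (\<phi> t) y)"
      by (intro continuous_attains_inf continuous_intros) auto
    then obtain x where x: "cmod x \<le> 1/2" "\<And>y. cmod y \<le> 1/2 \<Longrightarrow> cmod (deriv (\<phi> t) x) \<le> cmod (deriv (\<phi> t) y)"
      by auto
    define m where "m = cmod (deriv (\<phi> t) x)"
    have m: "m > 0"
      using holomorphic_injective_imp_regular[OF SD(1)[OF t] _ SD(2)[OF t], of x] x(1) by (simp add: m_def)
    define C where "C = max (1 / (c * e ^ 3)) (2 / (c * m\<^sup>2))"
    have C: "C > 0" unfolding C_def using c e m by (simp add: less_max_iff_disj)
    have "1 - cmod z \<le> C * cmod (P z) * (cmod (deriv (\<phi> t) z))\<^sup>2" if z: "cmod z < 1" for z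
    proof (cases "1/2 \<le> cmod z")
      case True
      then have "z \<noteq> 0" by auto
      have "1 - cmod z \<le> (1 / (c * cmod (\<phi> t z) ^ 3)) * cmod (P z) * (cmod (deriv (\<phi> t) z))\<^sup>2"
        by (rule core[OF z \<open>z \<noteq> 0\<close>])
      also have "\<dots> \<le> (1 / (c * e ^ 3)) * cmod (P z) * (cmod (deriv (\<phi> t) z))\<^sup>2"
      proof (intro mult_right_mono divide_left_mono mult_left_mono power_mono far True z)
        have "0 < cmod (\<phi> t z)" using far[OF z True] e(1) by linarith
        then show "0 < c * cmod (\<phi> t z) ^ 3 * (c * e ^ 3)" using c(1) e(1) by simp
      qed (use c e in auto)
      also have "\<dots> \<le> C * cmod (P z) * (cmod (deriv (\<phi> t) z))\<^sup>2"
        by (intro mult_right_mono) (auto simp: C_def)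
      finally show ?thesis .
    next
      case False
      have "c * (1/2) \<le> c * (1 - cmod z)" using c(1) False by (intro mult_left_mono) auto
      then have p: "c / 2 \<le> cmod (P z)" using c(2)[OF z] by simp
      have d: "m\<^sup>2 \<le> (cmod (deriv (\<phi> t) z))\<^sup>2"
        using x(2)[of z] m False by (intro power_mono) (auto simp: m_def)
      have "1 - cmod z \<le> 1" by simp
      also have "1 = (2 / (c * m\<^sup>2)) * (c / 2) * m\<^sup>2" using c m by simp
      also have "\<dots> \<le> C * cmod (P z) * (cmod (deriv (\<phi> t) z))\<^sup>2"
        using p d c m C by (intro mult_mono) (auto simp: C_def)
      finally show ?thesis .
    qed
    with hP ReP C show ?thesis unfolding inverse_derivative_majorant_def by blast
  qed
qed

section \<open>Flows in the right half-plane\<close>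

text \<open>
  Harnack's inequality, transported from the disk by the Cayley transform.
\<close>

lemma half_plane_Re_lower_bound:
  assumes Q: "Q holomorphic_on {w. Re w > 0}" and pos: "\<And>w. Re w > 0 \<Longrightarrow> Re (Q w) > 0"
    and w: "Re w > 0"
  shows "Re (Q 1) * (Re w / (cmod (1 + w))\<^sup>2) \<le> Re (Q w)"
proof -
  define C where "C z = (1 + z) / (1 - z)" for z :: complex
  define z where "z = (w - 1) / (w + 1)"
  have w1: "w + 1 \<noteq> 0" using w by (auto simp: complex_eq_iff)
  have z1: "1 - z = 2 / (w + 1)" "1 + z = 2 * w / (w + 1)" using w1 by (auto simp: z_def field_simps)
  have Cz: "C z = w" using w1 by (simp add: C_def z1)
  have zn: "z \<noteq> 1" using z1(1) w1 by auto
  have Rew: "Re w = (1 - (cmod z)\<^sup>2) / (cmod (1 - z))\<^sup>2"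
    using Re_Cayley[OF zn] Cz by (simp add: C_def)
  have eq: "Re w / (cmod (1 + w))\<^sup>2 = (1 - (cmod z)\<^sup>2) / 4"
    unfolding Rew z1 using w1 by (simp add: norm_divide power_divide add.commute)
  have "0 < Re w / (cmod (1 + w))\<^sup>2" using w w1 by (simp add: add.commute)
  then have z: "cmod z < 1" unfolding eq by (simp add: power_less_one_iff abs_square_less_1)
  have holC: "C holomorphic_on ball 0 1"
    unfolding C_def by (intro holomorphic_intros) auto
  have Cpos: "Re (C z) > 0" if "cmod z < 1" for z
    unfolding C_def by (rule Re_Cayley_pos[OF that])
  have "(1 - (cmod z)\<^sup>2) / 4 \<le> (1 - cmod z) / (1 + cmod z)"
  proof -
    have "(1 - (cmod z)\<^sup>2) * (1 + cmod z) = (1 - cmod z) * (1 + cmod z)\<^sup>2"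
      by (simp add: power2_eq_square algebra_simps)
    also have "\<dots> \<le> (1 - cmod z) * 2\<^sup>2"
      using z by (intro mult_left_mono power_mono) auto
    finally have "(1 - (cmod z)\<^sup>2) * (1 + cmod z) \<le> (1 - cmod z) * 4" by simp
    moreover have "1 + cmod z > 0" by (intro add_pos_nonneg) auto
    ultimately show ?thesis by (simp add: divide_le_eq pos_le_divide_eq)
  qed
  then have "Re (Q 1) * (Re w / (cmod (1 + w))\<^sup>2) \<le> Re (Q 1) * ((1 - cmod z) / (1 + cmod z))"
    unfolding eq using pos[of 1] by (intro mult_left_mono) auto
  also have "\<dots> \<le> Re (Q w)"
  proof -
    have "Re ((Q \<circ> C) 0) * ((1 - cmod z) / (1 + cmod z)) \<le> Re ((Q \<circ> C) z)"
      using Cpos pos by (intro Re_pos_disk_Schwarz(2) holomorphic_on_compose_gen[OF holC Q] z) auto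
    moreover have "C 0 = 1" by (simp add: C_def)
    ultimately show ?thesis by (simp only: o_def Cz)
  qed
  finally show ?thesis .
qed

text \<open>
  Let \<open>k' = Q = 1/H\<close>, so that \<open>k\<close> increases by exactly \<open>t\<close> along the orbit. Along the straight
  segment from \<open>u 0\<close> to \<open>u t = u 0 + \<Delta>\<close>, the average of \<open>Q\<close> is therefore \<open>t / \<Delta>\<close>, with real part
  \<open>t Re \<Delta> / \<bar>\<Delta>\<bar>\<^sup>2\<close>. On the other hand, by Harnack's inequality \<open>Re Q\<close> at the point \<open>u 0 + r \<Delta>\<close> is at
  least \<open>c r Re \<Delta> / (A + r \<bar>\<Delta>\<bar>)\<^sup>2\<close> with \<open>A = \<bar>1 + u 0\<bar>\<close>. Integrating over \<open>r\<close> yields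
  \<open>Re \<Delta> / \<bar>\<Delta>\<bar>\<^sup>2\<close> times a quantity that grows like \<open>ln (\<bar>\<Delta>\<bar> / A)\<close>. Since \<open>Re \<Delta> > 0\<close> can be
  cancelled, this logarithm is bounded in terms of \<open>t / c\<close> alone.
\<close>

lemma half_plane_orbit_growth:
  assumes H: "H holomorphic_on {w. Re w > 0}" and pos: "\<And>w. Re w > 0 \<Longrightarrow> Re (H w) > 0"
    and t: "t \<ge> 0"
    and u: "\<And>s. 0 \<le> s \<Longrightarrow> s \<le> t \<Longrightarrow> Re (u s) > 0"
      "\<And>s. 0 \<le> s \<Longrightarrow> s \<le> t \<Longrightarrow> (u has_vector_derivative H (u s)) (at s within {0..})"
  shows "cmod (1 + u t) \<le> exp (1 + t / Re (1 / H 1)) * cmod (1 + u 0)"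
proof -
  let ?HP = "{w. Re w > 0}"
  define Q where "Q w = 1 / H w" for w
  have Hnz: "H w \<noteq> 0" if "Re w > 0" for w using pos[OF that] by auto
  have hQ: "Q holomorphic_on ?HP" unfolding Q_def using Hnz by (intro holomorphic_intros H) auto
  have Qpos: "Re (Q w) > 0" if "Re w > 0" for w
  proof -
    have "(Re (H w))\<^sup>2 + (Im (H w))\<^sup>2 > 0" using pos[OF that] by (intro add_pos_nonneg) auto
    then show ?thesis using pos[OF that] by (simp add: Q_def Re_divide)
  qed
  define c where "c = Re (Q 1)"
  have c: "c > 0" unfolding c_def by (rule Qpos) simp
  have opn: "open ?HP" by (rule open_halfspace_Re_gt)
  have "convex ?HP" by (rule convex_halfspace_Re_gt)
  then obtain k where "\<And>w. w \<in> ?HP \<Longrightarrow> (k has_field_derivative Q w) (at w within ?HP)"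
    using holomorphic_convex_primitive'[OF _ opn hQ] by blast
  then have k: "(k has_field_derivative Q w) (at w)" if "Re w > 0" for w
    using that at_within_open[OF _ opn] by force
  define A D where "A = cmod (1 + u 0)" and "D = cmod (u t - u 0)"
  have u0: "Re (u 0) > 0" "Re (u t) > 0" using u(1) t by auto
  have A: "A > 0" unfolding A_def using u0(1) by (auto simp: complex_eq_iff)
  show ?thesis
  proof (cases "t = 0")
    case True
    then show ?thesis using mult_right_mono[of 1 "exp (1::real)" "cmod (1 + u 0)"] by simp
  next
    case False
    then have t0: "t > 0" using t by simp
    (* Strict monotonicity is essential: Re \<Delta> is cancelled at the end. *)
    have Re_inc: "Re (u 0) < Re (u t)"
    proof (rule DERIV_pos_imp_increasing_open[OF t0])
      have der: "((\<lambda>s. Re (u s)) has_real_derivative Re (H (u s))) (at s within {0..})" if "0 \<le> s" "s \<le> t" for s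
        using u(2)[OF that] by (simp add: has_real_derivative_iff_has_vector_derivative bounded_linear.has_vector_derivative[OF bounded_linear_Re])
      show "\<exists>y. ((\<lambda>s. Re (u s)) has_real_derivative y) (at s) \<and> 0 < y" if s: "0 < s" "s < t" for s
      proof -
        have "at s within {0..} = at s" using s by (intro at_within_interior) (simp add: interior_real_atLeast)
        then show ?thesis using der[of s] pos[OF u(1), of s] s by auto
      qed
      show "continuous_on {0..t} (\<lambda>s. Re (u s))"
        unfolding continuous_on_eq_continuous_within
      proof
        fix s assume "s \<in> {0..t}"
        then show "continuous (at s within {0..t}) (\<lambda>s. Re (u s))"
          using continuous_within_subset[OF DERIV_continuous[OF der[of s]], of "{0..t}"] by auto
      qed
    qed
    define \<Delta> where "\<Delta> = u t - u 0"
    have Re\<Delta>: "Re \<Delta> > 0" using Re_inc by (simp add: \<Delta>_def)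
    then have D: "D > 0" "\<Delta> \<noteq> 0" by (auto simp: D_def \<Delta>_def[symmetric])
    have kt: "k (u t) - k (u 0) = of_real t"
    proof -
      have "((\<lambda>s. k (u s) - of_real s) has_vector_derivative 0) (at s within {0..t})" if "s \<in> {0..t}" for s
      proof -
        have s: "0 \<le> s" "s \<le> t" using that by auto
        have "((k \<circ> u) has_vector_derivative H (u s) * Q (u s)) (at s within {0..})"
          by (rule field_vector_diff_chain_within[OF u(2)[OF s] has_field_derivative_at_within[OF k[OF u(1)[OF s]]]])
        moreover have "H (u s) * Q (u s) = 1" using Hnz[OF u(1)[OF s]] by (simp add: Q_def)
        ultimately have "((\<lambda>s. k (u s)) has_vector_derivative 1) (at s within {0..t})"
          by (auto simp: o_def intro: has_vector_derivative_within_subset)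
        moreover have "((\<lambda>s. complex_of_real s) has_vector_derivative 1) (at s within {0..t})"
          by (auto intro!: derivative_eq_intros)
        ultimately show ?thesis
          using has_vector_derivative_diff by fastforce
      qed
      then obtain q where "\<And>s. s \<in> {0..t} \<Longrightarrow> k (u s) - of_real s = q"
        using has_vector_derivative_zero_constant[of "{0..t}" "\<lambda>s. k (u s) - of_real s"] by auto
      from this[of 0] this[of t] t show ?thesis by (simp add: algebra_simps)
    qed
    (* F is the integral of Re Q along the segment minus its explicit lower bound: the term
       ln (A + r * D) + A / (A + r * D) is a primitive of r * D^2 / (A + r * D)^2. *)
    define F where "F r = Re (k (u 0 + of_real r * \<Delta>) / \<Delta>) - c * Re \<Delta> / D\<^sup>2 * (ln (A + r * D) + A / (A + r * D))" for r
    have "F 0 \<le> F 1"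
    proof (rule half_line_deriv_nonneg_imp_le)
      fix r :: real assume r: "0 \<le> r" "r \<le> 1"
      let ?w = "u 0 + of_real r * \<Delta>"
      have w: "Re ?w > 0" "r * Re \<Delta> \<le> Re ?w" using r u0 Re\<Delta> by (auto intro: add_pos_nonneg)
      have Ar: "A + r * D > 0" using A D r by (intro add_pos_nonneg) auto
      have "((\<lambda>r. u 0 + of_real r * \<Delta>) has_vector_derivative \<Delta>) (at r within {0..})"
        by (auto intro!: derivative_eq_intros)
      from field_vector_diff_chain_within[OF this has_field_derivative_at_within[OF k[OF w(1)]]]
      have "((\<lambda>r. k (u 0 + of_real r * \<Delta>)) has_vector_derivative \<Delta> * Q ?w) (at r within {0..})"
        by (simp add: o_def)
      then have "((\<lambda>r. k (u 0 + of_real r * \<Delta>) / \<Delta>) has_vector_derivative \<Delta> * Q ?w / \<Delta>) (at r within {0..})"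
        by (rule has_vector_derivative_divide)
      then have 1: "((\<lambda>r. Re (k (u 0 + of_real r * \<Delta>) / \<Delta>)) has_real_derivative Re (Q ?w)) (at r within {0..})"
        using D by (simp add: has_real_derivative_iff_has_vector_derivative bounded_linear.has_vector_derivative[OF bounded_linear_Re])
      have 2: "((\<lambda>r. ln (A + r * D) + A / (A + r * D)) has_real_derivative
          D / (A + r * D) - A * D / (A + r * D)\<^sup>2) (at r within {0..})"
        using Ar by (auto intro!: derivative_eq_intros simp: power2_eq_square)
      show "(F has_real_derivative Re (Q ?w) - c * Re \<Delta> / D\<^sup>2 * (D / (A + r * D) - A * D / (A + r * D)\<^sup>2)) (at r within {0..})"
        unfolding F_def by (intro DERIV_diff 1 DERIV_cmult 2)
      have "c * Re \<Delta> / D\<^sup>2 * (D / (A + r * D) - A * D / (A + r * D)\<^sup>2) = c * (r * Re \<Delta> / (A + r * D)\<^sup>2)"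
        using D Ar by (simp add: divide_simps power2_eq_square) (simp add: algebra_simps)
      also have "\<dots> \<le> c * (Re ?w / (cmod (1 + ?w))\<^sup>2)"
      proof (intro mult_left_mono frac_le)
        have "cmod (1 + ?w) \<le> cmod (1 + u 0) + cmod (of_real r * \<Delta>)"
          using norm_triangle_ineq[of "1 + u 0" "of_real r * \<Delta>"] by (simp add: add.assoc)
        also have "\<dots> = A + r * D" using r by (simp add: A_def D_def \<Delta>_def norm_mult)
        finally show "(cmod (1 + ?w))\<^sup>2 \<le> (A + r * D)\<^sup>2" by (intro power_mono) auto
        have "1 + ?w \<noteq> 0" using w by (auto simp: complex_eq_iff)
        then show "0 < (cmod (1 + ?w))\<^sup>2" by simp
      qed (use w c r Re\<Delta> in auto)
      also have "\<dots> \<le> Re (Q ?w)"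
        unfolding c_def by (rule half_plane_Re_lower_bound[OF hQ Qpos w(1)])
      finally show "0 \<le> Re (Q ?w) - c * Re \<Delta> / D\<^sup>2 * (D / (A + r * D) - A * D / (A + r * D)\<^sup>2)" by simp
    qed simp
    moreover have "F 0 = Re (k (u 0) / \<Delta>) - c * Re \<Delta> / D\<^sup>2 * (ln A + 1)"
      using A by (simp add: F_def)
    moreover have "u 0 + \<Delta> = u t" by (simp add: \<Delta>_def)
    then have "F 1 = Re (k (u t) / \<Delta>) - c * Re \<Delta> / D\<^sup>2 * (ln (A + D) + A / (A + D))"
      by (simp add: F_def)
    ultimately have "c * Re \<Delta> / D\<^sup>2 * ((ln (A + D) + A / (A + D)) - (ln A + 1)) \<le> Re (k (u t) / \<Delta>) - Re (k (u 0) / \<Delta>)"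
      by (simp only: right_diff_distrib)
    also have "\<dots> = Re ((k (u t) - k (u 0)) / \<Delta>)" by (simp add: diff_divide_distrib)
    also have "\<dots> = (Re \<Delta> / D\<^sup>2) * t"
      unfolding kt by (simp add: Re_divide cmod_power2 D_def \<Delta>_def[symmetric])
    finally have "(Re \<Delta> / D\<^sup>2) * (c * ((ln (A + D) + A / (A + D)) - (ln A + 1))) \<le> (Re \<Delta> / D\<^sup>2) * t"
      by (simp add: mult_ac)
    moreover have "Re \<Delta> / D\<^sup>2 > 0" using Re\<Delta> D by simp
    ultimately have "c * ((ln (A + D) + A / (A + D)) - (ln A + 1)) \<le> t"
      by (simp only: mult_le_cancel_left_pos)
    then have "(ln (A + D) + A / (A + D)) - (ln A + 1) \<le> t / c"
      using c by (simp add: pos_le_divide_eq mult.commute)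
    moreover have "A / (A + D) > 0" using A D by simp
    ultimately have "ln (A + D) \<le> ln A + (1 + t / c)" by linarith
    then have "exp (ln (A + D)) \<le> exp (ln A + (1 + t / c))" by simp
    then have "A + D \<le> exp (1 + t / c) * A" using A D by (simp add: exp_add mult.commute)
    moreover have "cmod (1 + u t) \<le> A + D"
      using norm_triangle_ineq[of "1 + u 0" "u t - u 0"] by (simp add: A_def D_def)
    ultimately show ?thesis by (simp add: A_def c_def Q_def)
  qed
qed

text \<open>
  If \<open>Re H\<close> vanishes somewhere, then \<open>H\<close> is constant and the orbits are translations.
\<close>

lemma half_plane_orbit_growth_ex:
  assumes H: "H holomorphic_on {w. Re w > 0}" and nn: "\<And>w. Re w > 0 \<Longrightarrow> Re (H w) \<ge> 0"
    and t: "t \<ge> 0"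
  obtains K where "K > 0" "\<And>u. (\<And>s. 0 \<le> s \<Longrightarrow> s \<le> t \<Longrightarrow> Re (u s) > 0) \<Longrightarrow>
      (\<And>s. 0 \<le> s \<Longrightarrow> s \<le> t \<Longrightarrow> (u has_vector_derivative H (u s)) (at s within {0..})) \<Longrightarrow>
      cmod (1 + u t) \<le> K * cmod (1 + u 0)"
proof (cases "\<exists>w. Re w > 0 \<and> Re (H w) = 0")
  case False
  then have pos: "Re (H w) > 0" if "Re w > 0" for w using nn[OF that] that by force
  show thesis
    by (rule that[of "exp (1 + t / Re (1 / H 1))"]) (use half_plane_orbit_growth[OF H pos t] in auto)
next
  case True
  have "connected {w. Re w > 0}" by (simp add: convex_connected convex_halfspace_Re_gt)
  then have "H constant_on {w. Re w > 0}"
    using Re_nonneg_vanishing_imp_constant[OF H open_halfspace_Re_gt] nn True by auto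
  then obtain h where h: "\<And>w. Re w > 0 \<Longrightarrow> H w = h" by (auto simp: constant_on_def)
  show thesis
  proof (rule that[of "1 + cmod h * t"])
    show "1 + cmod h * t > 0" using t by (intro add_pos_nonneg) auto
    fix u :: "real \<Rightarrow> complex"
    assume u: "\<And>s. 0 \<le> s \<Longrightarrow> s \<le> t \<Longrightarrow> Re (u s) > 0"
      "\<And>s. 0 \<le> s \<Longrightarrow> s \<le> t \<Longrightarrow> (u has_vector_derivative H (u s)) (at s within {0..})"
    have "((\<lambda>s. u s - of_real s * h) has_vector_derivative 0) (at s within {0..t})" if "s \<in> {0..t}" for s
    proof -
      have "(u has_vector_derivative h) (at s within {0..t})"
        using u(2)[of s] h[OF u(1)[of s]] that by (auto intro: has_vector_derivative_within_subset)
      moreover have "((\<lambda>s. of_real s * h) has_vector_derivative h) (at s within {0..t})"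
        by (auto intro!: derivative_eq_intros)
      ultimately show ?thesis using has_vector_derivative_diff by fastforce
    qed
    then obtain q where "\<And>s. s \<in> {0..t} \<Longrightarrow> u s - of_real s * h = q"
      using has_vector_derivative_zero_constant[of "{0..t}" "\<lambda>s. u s - of_real s * h"] by auto
    from this[of 0] this[of t] t have "u t = u 0 + of_real t * h" by (simp add: algebra_simps)
    then have "cmod (1 + u t) \<le> cmod (1 + u 0) + cmod h * t * 1"
      using norm_triangle_ineq[of "1 + u 0" "of_real t * h"] t by (simp add: norm_mult mult.commute add.assoc)
    also have "1 \<le> cmod (1 + u 0)"
      using complex_Re_le_cmod[of "1 + u 0"] u(1)[of 0] t by simp
    then have "cmod (1 + u 0) + cmod h * t * 1 \<le> cmod (1 + u 0) + cmod h * t * cmod (1 + u 0)"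
      using t by (intro add_left_mono mult_left_mono) auto
    finally show "cmod (1 + u t) \<le> (1 + cmod h * t) * cmod (1 + u 0)" by (simp add: algebra_simps)
  qed
qed

section \<open>Semigroups with Wolff point on the circle\<close>

text \<open>
  The analogue of the computation for a fixed origin, with \<open>a = \<bar>\<phi>\<^sub>t z\<bar>\<close>, \<open>b = \<bar>z\<bar>\<close>, \<open>d = \<bar>\<tau> - z\<bar>\<close>,
  \<open>e = \<bar>\<tau> - \<phi>\<^sub>t z\<bar>\<close>, \<open>D = \<bar>\<phi>\<^sub>t' z\<bar>\<close>, \<open>v = \<bar>P z\<bar>\<close> and \<open>w = \<bar>P (\<phi>\<^sub>t z)\<bar>\<close>. The factor \<open>(d/e)\<^sup>6\<close> is the price of
  returning from the half-plane, where \<open>\<bar>1 + u\<bar> = 2 / \<bar>\<tau> - z\<bar>\<close>, and \<open>growth\<close> is the bound on orbits.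
\<close>

lemma boundary_flow_derivative_bound:
  fixes a b c D K d e v w :: real
  assumes a: "0 \<le> a" "a < 1" and b: "0 \<le> b" "b < 1" and pos: "c > 0" "v > 0" "d > 0" "e > 0" "K > 0" "D \<ge> 0"
    and eq: "w * e\<^sup>2 = D * v * d\<^sup>2" and mono: "v * ((1 - b\<^sup>2) / d\<^sup>2) \<le> w * ((1 - a\<^sup>2) / e\<^sup>2)"
    and low: "c * (1 - a) \<le> w" and growth: "d \<le> K * e"
  shows "1 - b \<le> (2 / c * K ^ 6) * v * D\<^sup>2"
proof -
  have w: "w = D * v * d\<^sup>2 / e\<^sup>2" using eq pos by (simp add: field_simps)
  have w0: "w \<ge> 0" unfolding w using pos by simp
  have "1 - a\<^sup>2 = (1 - a) * (1 + a)" by (simp add: power2_eq_square algebra_simps)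
  also have "\<dots> \<le> (1 - a) * 2" using a by (intro mult_left_mono) auto
  also have "\<dots> \<le> (w / c) * 2" using low pos by (intro mult_right_mono) (auto simp: field_simps)
  finally have "w * ((1 - a\<^sup>2) / e\<^sup>2) \<le> w * ((w / c) * 2 / e\<^sup>2)"
    using w0 by (intro mult_left_mono divide_right_mono) auto
  with mono have "v * ((1 - b\<^sup>2) / d\<^sup>2) \<le> w * ((w / c) * 2 / e\<^sup>2)" by linarith
  also have "\<dots> = v * ((2 / c) * D\<^sup>2 * v * (d / e) ^ 6 / d\<^sup>2)"
    unfolding w using pos by (simp add: field_simps power2_eq_square power_numeral_reduce)
  finally have "(1 - b\<^sup>2) / d\<^sup>2 \<le> (2 / c) * D\<^sup>2 * v * (d / e) ^ 6 / d\<^sup>2"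
    using pos(2) by (simp only: mult_le_cancel_left_pos)
  then have "1 - b\<^sup>2 \<le> (2 / c) * D\<^sup>2 * v * (d / e) ^ 6"
    using pos(3) unfolding divide_le_cancel by simp
  also have "\<dots> \<le> (2 / c) * D\<^sup>2 * v * K ^ 6"
    using pos growth by (intro mult_left_mono power_mono) (auto simp: divide_le_eq)
  finally have "1 - b\<^sup>2 \<le> (2 / c * K ^ 6) * v * D\<^sup>2" by (simp add: mult_ac)
  moreover have "b\<^sup>2 \<le> b" using b by (simp add: power2_eq_square mult_left_le)
  ultimately show ?thesis by linarith
qed

lemma half_plane_to_disk:
  assumes \<tau>: "cmod \<tau> = 1" and w: "Re w > 0"
  shows "cmod (\<tau> * (w - 1) / (w + 1)) < 1"
proof -
  have "w + 1 \<noteq> 0" using w by (auto simp: complex_eq_iff)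
  moreover have "(cmod (w - 1))\<^sup>2 < (cmod (w + 1))\<^sup>2"
    unfolding cmod_power2 using w by (simp add: power2_eq_square algebra_simps)
  then have "cmod (w - 1) < cmod (w + 1)" by (rule power_less_imp_less_base) simp
  ultimately show ?thesis using \<tau> by (simp add: norm_mult norm_divide)
qed

lemma disk_to_half_plane:
  assumes \<tau>: "cmod \<tau> = 1" and z: "cmod z < 1"
  shows "\<tau> - z \<noteq> 0"
    and "Re ((\<tau> + z) / (\<tau> - z)) = (1 - (cmod z)\<^sup>2) / (cmod (\<tau> - z))\<^sup>2"
    and "Re ((\<tau> + z) / (\<tau> - z)) > 0"
    and "cmod (1 + (\<tau> + z) / (\<tau> - z)) = 2 / cmod (\<tau> - z)"
    and "\<tau> * ((\<tau> + z) / (\<tau> - z) - 1) / ((\<tau> + z) / (\<tau> - z) + 1) = z"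
    and "cmod (1 - cnj \<tau> * z) = cmod (\<tau> - z)"
proof -
  show nz: "\<tau> - z \<noteq> 0" using assms by auto
  have \<tau>0: "\<tau> \<noteq> 0" using \<tau> by auto
  have "(Re \<tau>)\<^sup>2 + (Im \<tau>)\<^sup>2 = 1" using \<tau> cmod_power2[of \<tau>] by simp
  then have "Re \<tau> * Re \<tau> + Im \<tau> * Im \<tau> = 1" by (simp add: power2_eq_square)
  then show "Re ((\<tau> + z) / (\<tau> - z)) = (1 - (cmod z)\<^sup>2) / (cmod (\<tau> - z))\<^sup>2"
    unfolding Re_divide cmod_power2 by (simp add: power2_eq_square algebra_simps)
  moreover have "1 - (cmod z)\<^sup>2 > 0" using z by (simp add: abs_square_less_1)
  ultimately show "Re ((\<tau> + z) / (\<tau> - z)) > 0" using nz by simp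
  have sum: "1 + (\<tau> + z) / (\<tau> - z) = 2 * \<tau> / (\<tau> - z)" using nz by (simp add: field_simps)
  then show "cmod (1 + (\<tau> + z) / (\<tau> - z)) = 2 / cmod (\<tau> - z)"
    using \<tau> by (simp add: norm_divide norm_mult)
  have "(\<tau> + z) / (\<tau> - z) - 1 = 2 * z / (\<tau> - z)" using nz by (simp add: field_simps)
  then show "\<tau> * ((\<tau> + z) / (\<tau> - z) - 1) / ((\<tau> + z) / (\<tau> - z) + 1) = z"
    using sum nz \<tau>0 by (simp add: add.commute)
  have "1 - cnj \<tau> * z = cnj \<tau> * (\<tau> - z)"
    using \<tau> complex_norm_square[of \<tau>] by (simp add: algebra_simps)
  then show "cmod (1 - cnj \<tau> * z) = cmod (\<tau> - z)" using \<tau> by (simp add: norm_mult)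
qed

text \<open>
  In the coordinate \<open>u = (\<tau> + z) / (\<tau> - z)\<close> the flow is \<open>u' = H u\<close>, where \<open>H\<close> corresponds to
  \<open>P z = 2 \<tau> G z / (\<tau> - z)\<^sup>2\<close>. The Julia inequality says that \<open>Re u\<close> increases along orbits, whence
  \<open>Re P \<ge> 0\<close>.
\<close>

lemma boundary_inverse_derivative_majorant:
  assumes S: "continuous_conformal_semigroup \<phi>" and \<tau>: "cmod \<tau> = 1"
    and J: "\<And>t. t \<ge> 0 \<Longrightarrow> Julia_at \<tau> (\<phi> t)" and t: "t \<ge> 0"
  shows "inverse_derivative_majorant (\<phi> t)"
proof -
  note SD = continuous_conformal_semigroupD[OF S]
  note DH = disk_to_half_plane[OF \<tau>]
  obtain G where hG: "G holomorphic_on ball 0 1"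
    and G: "\<And>z s. cmod z < 1 \<Longrightarrow> s \<ge> 0 \<Longrightarrow> ((\<lambda>t. \<phi> t z) has_vector_derivative G (\<phi> s z)) (at s within {0..})"
    using semigroup_generator[OF S] by blast
  define P where "P z = 2 * \<tau> * G z / (\<tau> - z)\<^sup>2" for z
  define E where "E z = (\<tau> + z) / (\<tau> - z)" for z
  define H where "H w = P (\<tau> * (w - 1) / (w + 1))" for w
  have HE: "H (E z) = P z" if "cmod z < 1" for z
    using DH(5)[OF that] by (simp add: H_def E_def)
  have hP: "P holomorphic_on ball 0 1"
    unfolding P_def using DH(1) by (intro holomorphic_intros hG) auto
  have \<tau>0: "\<tau> \<noteq> 0" using \<tau> by auto
  have u: "((\<lambda>t. E (\<phi> t z)) has_vector_derivative H (E (\<phi> s z))) (at s within {0..})"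
    if z: "cmod z < 1" and s: "s \<ge> 0" for z s
  proof -
    let ?w = "\<phi> s z"
    have w: "cmod ?w < 1" by (rule SD(3)[OF s z])
    have "(E has_field_derivative 2 * \<tau> / (\<tau> - ?w)\<^sup>2) (at ?w)"
      unfolding E_def using DH(1)[OF w]
      by (auto intro!: derivative_eq_intros simp: power2_eq_square field_simps)
    from field_vector_diff_chain_within[OF G[OF z s] has_field_derivative_at_within[OF this]]
    have "((\<lambda>t. E (\<phi> t z)) has_vector_derivative G ?w * (2 * \<tau> / (\<tau> - ?w)\<^sup>2)) (at s within {0..})"
      by (simp add: o_def)
    then show ?thesis using HE[OF w] by (simp add: P_def mult_ac)
  qed
  have Re_u: "((\<lambda>t. Re (E (\<phi> t z))) has_real_derivative Re (P (\<phi> s z))) (at s within {0..})"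
    if z: "cmod z < 1" and s: "s \<ge> 0" for z s
    using u[OF that] HE[OF SD(3)[OF s z]]
    by (simp add: has_real_derivative_iff_has_vector_derivative bounded_linear.has_vector_derivative[OF bounded_linear_Re])
  have ReP: "Re (P z) \<ge> 0" if z: "cmod z < 1" for z
  proof -
    have "0 \<le> Re (P (\<phi> 0 z))"
    proof (rule half_line_increasing_imp_deriv_nonneg[OF Re_u[OF z order_refl]])
      fix s :: real assume s: "s \<ge> 0"
      have w: "cmod (\<phi> s z) < 1" by (rule SD(3)[OF s z])
      have "(cmod (\<tau> - \<phi> s z))\<^sup>2 * (1 - (cmod z)\<^sup>2) \<le> (cmod (\<tau> - z))\<^sup>2 * (1 - (cmod (\<phi> s z))\<^sup>2)"
        using J[OF s] z unfolding Julia_at_def DH(6)[OF z, symmetric] DH(6)[OF w, symmetric] by blast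
      moreover have "(cmod (\<tau> - \<phi> s z))\<^sup>2 > 0" "(cmod (\<tau> - z))\<^sup>2 > 0" using DH(1)[OF w] DH(1)[OF z] by auto
      ultimately have "(1 - (cmod z)\<^sup>2) / (cmod (\<tau> - z))\<^sup>2 \<le> (1 - (cmod (\<phi> s z))\<^sup>2) / (cmod (\<tau> - \<phi> s z))\<^sup>2"
        by (simp add: frac_le_eq divide_le_0_iff pos_divide_le_eq pos_le_divide_eq mult_ac)
      then show "Re (E (\<phi> 0 z)) \<le> Re (E (\<phi> s z))"
        unfolding SD(4)[OF z] E_def DH(2)[OF z] DH(2)[OF w] .
    qed
    then show ?thesis by (simp add: SD(4)[OF z])
  qed
  show ?thesis
  proof (cases "\<exists>a. cmod a < 1 \<and> P a \<noteq> 0")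
    case False
    then have "G z = 0" if "cmod z < 1" for z
      using that DH(1)[OF that] \<tau>0 by (auto simp: P_def)
    with inverse_derivative_majorant_trivial_generator[OF S t G] show ?thesis by blast
  next
    case True
    then obtain c where c: "c > 0" "\<And>z. cmod z < 1 \<Longrightarrow> c * (1 - cmod z) \<le> cmod (P z)"
      using Re_nonneg_disk_lower_bound[OF hP ReP] by metis
    have Pnz: "cmod (P z) > 0" if "cmod z < 1" for z
    proof -
      have "0 < c * (1 - cmod z)" using c(1) that by simp
      then show ?thesis using c(2)[OF that] by linarith
    qed
    have hH: "H holomorphic_on {w. Re w > 0}"
    proof -
      have "(\<lambda>w. \<tau> * (w - 1) / (w + 1)) holomorphic_on {w. Re w > 0}"
        by (intro holomorphic_intros) (auto simp: complex_eq_iff)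
      then have "(P \<circ> (\<lambda>w. \<tau> * (w - 1) / (w + 1))) holomorphic_on {w. Re w > 0}"
        using half_plane_to_disk[OF \<tau>] by (intro holomorphic_on_compose_gen[OF _ hP]) auto
      then show ?thesis by (simp add: H_def[abs_def] o_def)
    qed
    have ReH: "Re (H w) \<ge> 0" if "Re w > 0" for w
      unfolding H_def by (rule ReP[OF half_plane_to_disk[OF \<tau> that]])
    obtain K where K: "K > 0" "\<And>u. (\<And>s. 0 \<le> s \<Longrightarrow> s \<le> t \<Longrightarrow> Re (u s) > 0) \<Longrightarrow>
      (\<And>s. 0 \<le> s \<Longrightarrow> s \<le> t \<Longrightarrow> (u has_vector_derivative H (u s)) (at s within {0..})) \<Longrightarrow>
      cmod (1 + u t) \<le> K * cmod (1 + u 0)"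
      using half_plane_orbit_growth_ex[OF hH ReH t] by blast
    have "1 - cmod z \<le> (2 / c * K ^ 6) * cmod (P z) * (cmod (deriv (\<phi> t) z))\<^sup>2" if z: "cmod z < 1" for z
    proof (rule boundary_flow_derivative_bound[where a = "cmod (\<phi> t z)" and d = "cmod (\<tau> - z)"
          and e = "cmod (\<tau> - \<phi> t z)" and w = "cmod (P (\<phi> t z))"])
      have \<phi>1: "cmod (\<phi> s z) < 1" if "s \<ge> 0" for s using SD(3)[OF that z] .
      have Epos: "Re (E (\<phi> s z)) > 0" if "s \<ge> 0" for s unfolding E_def by (rule DH(3)[OF \<phi>1[OF that]])
      show "cmod (\<phi> t z) < 1" by (rule \<phi>1[OF t])
      then show "c * (1 - cmod (\<phi> t z)) \<le> cmod (P (\<phi> t z))" by (rule c(2))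
      show "0 < cmod (\<tau> - z)" "0 < cmod (\<tau> - \<phi> t z)" using DH(1)[OF z] DH(1)[OF \<phi>1[OF t]] by auto
      have "P (\<phi> t z) * (\<tau> - \<phi> t z)\<^sup>2 = deriv (\<phi> t) z * P z * (\<tau> - z)\<^sup>2"
        using semigroup_generator_commutes[OF S G z t] DH(1)[OF z] DH(1)[OF \<phi>1[OF t]] by (simp add: P_def)
      from arg_cong[OF this, of cmod]
      show "cmod (P (\<phi> t z)) * (cmod (\<tau> - \<phi> t z))\<^sup>2 = cmod (deriv (\<phi> t) z) * cmod (P z) * (cmod (\<tau> - z))\<^sup>2"
        by (simp add: norm_mult norm_power)
      have "cmod (1 + E (\<phi> t z)) \<le> K * cmod (1 + E (\<phi> 0 z))"
        by (rule K(2)) (use u[OF z] Epos in auto)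
      then have "2 / cmod (\<tau> - \<phi> t z) \<le> K * (2 / cmod (\<tau> - z))"
        unfolding SD(4)[OF z] E_def DH(4)[OF z] DH(4)[OF \<phi>1[OF t]] .
      then show "cmod (\<tau> - z) \<le> K * cmod (\<tau> - \<phi> t z)"
        using DH(1)[OF z] DH(1)[OF \<phi>1[OF t]] by (simp add: field_simps)
      have "cmod (H (E (\<phi> 0 z))) * Re (E (\<phi> 0 z)) \<le> cmod (H (E (\<phi> t z))) * Re (E (\<phi> t z))"
      proof (rule norm_times_weight_increasing[OF _ _ _ _ t])
        fix s assume s: "0 \<le> s" "s \<le> t"
        let ?w = "E (\<phi> s z)"
        note w = Epos[OF s(1)]
        show "0 \<le> Re ?w" using w by simp
        show "((\<lambda>s. Re (E (\<phi> s z))) has_real_derivative Re (H ?w)) (at s within {0..})"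
          using Re_u[OF z s(1)] HE[OF \<phi>1[OF s(1)]] by simp
        have "(H has_field_derivative deriv H ?w) (at ?w within (\<lambda>s. E (\<phi> s z)) ` {0..})"
          using holomorphic_derivI[OF hH open_halfspace_Re_gt, of ?w] w by (simp add: has_field_derivative_at_within)
        from field_vector_diff_chain_within[OF u[OF z s(1)] this]
        show "((\<lambda>s. H (E (\<phi> s z))) has_vector_derivative H ?w * deriv H ?w) (at s within {0..})"
          by (simp add: o_def)
        have "cmod (H ?w) * (cmod (deriv H ?w) * Re ?w) \<le> cmod (H ?w) * Re (H ?w)"
          by (intro mult_left_mono half_plane_deriv_le[OF hH ReH w]) auto
        then show "cmod (H ?w * deriv H ?w) * Re ?w \<le> cmod (H ?w) * Re (H ?w)"
          by (simp add: norm_mult mult_ac)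
      qed
      then show "cmod (P z) * ((1 - (cmod z)\<^sup>2) / (cmod (\<tau> - z))\<^sup>2) \<le>
         cmod (P (\<phi> t z)) * ((1 - (cmod (\<phi> t z))\<^sup>2) / (cmod (\<tau> - \<phi> t z))\<^sup>2)"
        unfolding HE[OF \<phi>1[OF t]] SD(4)[OF z] HE[OF z]
        unfolding E_def DH(2)[OF z] DH(2)[OF \<phi>1[OF t]] .
    qed (use z c K Pnz in auto)
    moreover have "2 / c * K ^ 6 > 0" using c K by simp
    ultimately show ?thesis using hP ReP unfolding inverse_derivative_majorant_def by blast
  qed
qed

section \<open>Semigroups with an interior fixed point\<close>

lemma Moebius_has_field_derivative:
  assumes a: "cmod a < 1" and z: "cmod z < 1"
  shows "(Moebius_function 0 a has_field_derivative of_real (1 - (cmod a)\<^sup>2) / (1 - cnj a * z)\<^sup>2) (at z)"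
proof -
  have nz: "1 - cnj a * z \<noteq> 0" using one_minus_cnj_mult_nonzero[of a z] a z by simp
  have aa: "of_real ((cmod a)\<^sup>2) = a * cnj a" by (rule complex_norm_square)
  show ?thesis
    unfolding Moebius_function_simple[abs_def] of_real_diff aa
    using nz by (auto intro!: derivative_eq_intros simp: power2_eq_square) (simp add: algebra_simps)
qed

lemma Moebius_deriv_lower_bound:
  assumes a: "cmod a < 1" and z: "cmod z < 1"
  shows "(1 - (cmod a)\<^sup>2) / 4 \<le> cmod (deriv (Moebius_function 0 a) z)"
proof -
  have nz: "1 - cnj a * z \<noteq> 0" using one_minus_cnj_mult_nonzero[of a z] a z by simp
  have a2: "1 - (cmod a)\<^sup>2 > 0" using a by (simp add: abs_square_less_1)
  have "cmod (cnj a * z) \<le> 1 * 1" unfolding norm_mult using a z by (intro mult_mono) auto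
  then have "cmod (1 - cnj a * z) \<le> 2" using norm_triangle_ineq4[of 1 "cnj a * z"] by simp
  then have "(cmod (1 - cnj a * z))\<^sup>2 \<le> 2\<^sup>2" by (intro power_mono) auto
  then have "(1 - (cmod a)\<^sup>2) / 4 \<le> (1 - (cmod a)\<^sup>2) / (cmod (1 - cnj a * z))\<^sup>2"
    using a2 nz by (intro divide_left_mono) auto
  also have "\<dots> = cmod (deriv (Moebius_function 0 a) z)"
    unfolding DERIV_imp_deriv[OF Moebius_has_field_derivative[OF a z]] norm_divide norm_power norm_of_real
    using a2 by simp
  finally show ?thesis .
qed

lemma Moebius_boundary_distance:
  assumes a: "cmod a < 1" and z: "cmod z < 1"
  shows "(1 - (cmod a)\<^sup>2) / 8 * (1 - cmod z) \<le> 1 - cmod (Moebius_function 0 a z)"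
proof -
  let ?M = "Moebius_function 0 a z"
  define x where "x = cmod ?M"
  have nz: "1 - cnj a * z \<noteq> 0" using one_minus_cnj_mult_nonzero[of a z] a z by simp
  have a2: "1 - (cmod a)\<^sup>2 > 0" using a by (simp add: abs_square_less_1)
  have x: "0 \<le> x" "x < 1" using Moebius_function_norm_lt_1[OF a z] by (auto simp: x_def)
  have "x\<^sup>2 = (cmod (z - a))\<^sup>2 / (cmod (1 - cnj a * z))\<^sup>2"
    by (simp add: x_def Moebius_function_simple norm_divide power_divide)
  then have x2: "1 - x\<^sup>2 = (1 - (cmod a)\<^sup>2) * (1 - (cmod z)\<^sup>2) / (cmod (1 - cnj a * z))\<^sup>2"
    using nz by (simp only: norm_Moebius_identity[of z a]) (simp add: field_simps)
  have "cmod (cnj a * z) \<le> 1 * 1" unfolding norm_mult using a z by (intro mult_mono) auto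
  then have "cmod (1 - cnj a * z) \<le> 2" using norm_triangle_ineq4[of 1 "cnj a * z"] by simp
  then have le4: "(cmod (1 - cnj a * z))\<^sup>2 \<le> 2\<^sup>2" by (intro power_mono) auto
  have "(cmod z)\<^sup>2 \<le> cmod z" using z by (simp add: power2_eq_square mult_left_le)
  then have "(1 - (cmod a)\<^sup>2) * (1 - cmod z) / 4 \<le> (1 - (cmod a)\<^sup>2) * (1 - (cmod z)\<^sup>2) / 4"
    using a2 by (intro divide_right_mono mult_left_mono) auto
  also have "\<dots> \<le> 1 - x\<^sup>2"
    unfolding x2 using a a2 nz le4 z by (intro divide_left_mono) (auto simp: abs_square_le_1 intro!: mult_nonneg_nonneg)
  also have "\<dots> = (1 - x) * (1 + x)" by (simp add: power2_eq_square algebra_simps)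
  also have "\<dots> \<le> (1 - x) * 2" using x by (intro mult_left_mono) auto
  finally show ?thesis by (simp add: x_def)
qed

text \<open>
  Conjugation by the Moebius transformation \<open>M\<close> that maps \<open>\<tau>\<close> to 0 changes the derivatives and the
  distance to the circle only by bounded factors, and \<open>P \<circ> M\<close> again has nonnegative real part.
\<close>

lemma interior_inverse_derivative_majorant:
  assumes S: "continuous_conformal_semigroup \<phi>" and \<tau>: "cmod \<tau> < 1"
    and fp: "\<And>t. t \<ge> 0 \<Longrightarrow> \<phi> t \<tau> = \<tau>" and t: "t \<ge> 0"
  shows "inverse_derivative_majorant (\<phi> t)"
proof -
  note SD = continuous_conformal_semigroupD[OF S]
  define M where "M = Moebius_function 0 \<tau>"
  define N where "N = Moebius_function 0 (- \<tau>)"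
  have \<tau>': "cmod (- \<tau>) < 1" using \<tau> by simp
  have M1: "cmod (M w) < 1" and N1: "cmod (N w) < 1" and NM: "N (M w) = w" and MN: "M (N w) = w" if "cmod w < 1" for w
    using that \<tau> Moebius_function_norm_lt_1 Moebius_function_compose[of "-\<tau>" \<tau> w] Moebius_function_compose[of \<tau> "-\<tau>" w]
    by (auto simp: M_def N_def)
  have N0: "N 0 = \<tau>" and M\<tau>: "M \<tau> = 0"
    by (auto simp: N_def M_def Moebius_function_of_zero Moebius_function_eq_zero)
  have hol: "M holomorphic_on ball 0 1" "N holomorphic_on ball 0 1"
    using \<tau> by (auto simp: M_def N_def intro: Moebius_function_holomorphic)
  define \<psi> where "\<psi> s z = M (\<phi> s (N z))" for s z
  have S\<psi>: "continuous_conformal_semigroup \<psi>"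
    unfolding continuous_conformal_semigroup_def conformal_self_map_def
  proof (intro conjI allI impI ballI)
    fix s :: real assume s: "0 \<le> s"
    have "(\<phi> s \<circ> N) holomorphic_on ball 0 1"
      using N1 by (intro holomorphic_on_compose_gen[OF hol(2) SD(1)[OF s]]) auto
    then have "(M \<circ> (\<phi> s \<circ> N)) holomorphic_on ball 0 1"
      using N1 SD(3)[OF s] by (intro holomorphic_on_compose_gen[OF _ hol(1)]) auto
    then show "\<psi> s holomorphic_on ball 0 1" by (simp add: \<psi>_def[abs_def] o_def)
    show "inj_on (\<psi> s) (ball 0 1)"
    proof (rule inj_onI)
      fix x y :: complex assume xy: "x \<in> ball 0 1" "y \<in> ball 0 1" "\<psi> s x = \<psi> s y"
      then have n: "cmod x < 1" "cmod y < 1" by auto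
      have "\<phi> s (N x) = \<phi> s (N y)"
        using arg_cong[OF xy(3), of N] NM SD(3)[OF s N1[OF n(1)]] SD(3)[OF s N1[OF n(2)]] by (simp add: \<psi>_def)
      then have "N x = N y" using inj_onD[OF SD(2)[OF s]] N1 n by simp
      then show "x = y" using MN n by metis
    qed
    show "\<psi> s ` ball 0 1 \<subseteq> ball 0 1" using M1 SD(3)[OF s] N1 by (auto simp: \<psi>_def)
  next
    fix z :: complex assume "z \<in> ball 0 1"
    then have z: "cmod z < 1" by simp
    show "\<psi> 0 z = z" using SD(4)[OF N1[OF z]] MN[OF z] by (simp add: \<psi>_def)
    show "\<psi> (r + s) z = \<psi> r (\<psi> s z)" if "0 \<le> s" "0 \<le> r" for s r
      using SD(5)[OF that N1[OF z]] NM[OF SD(3)[OF that(1) N1[OF z]]] by (simp add: \<psi>_def)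
    show "continuous_on {0..} (\<lambda>t. \<psi> t z)"
      unfolding \<psi>_def
    proof (rule continuous_on_compose2[OF holomorphic_on_imp_continuous_on[OF hol(1)] SD(6)[OF N1[OF z]]])
      show "(\<lambda>t. \<phi> t (N z)) ` {0..} \<subseteq> ball 0 1" using SD(3)[OF _ N1[OF z]] by auto
    qed
  qed
  have "\<psi> s 0 = 0" if "s \<ge> 0" for s using fp[OF that] by (simp add: \<psi>_def N0 M\<tau>)
  from elliptic_inverse_derivative_majorant[OF S\<psi> this t]
  obtain P C where P: "P holomorphic_on ball 0 1" "\<And>z. cmod z < 1 \<Longrightarrow> Re (P z) \<ge> 0" "C > 0"
    and PC: "\<And>z. cmod z < 1 \<Longrightarrow> 1 - cmod z \<le> C * cmod (P z) * (cmod (deriv (\<psi> t) z))\<^sup>2"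
    unfolding inverse_derivative_majorant_def by blast
  define m where "m = (1 - (cmod \<tau>)\<^sup>2) / 4"
  have m: "m > 0" using \<tau> by (simp add: m_def abs_square_less_1)
  have "1 - cmod z \<le> (2 / m * C / m ^ 4) * cmod ((P \<circ> M) z) * (cmod (deriv (\<phi> t) z))\<^sup>2" if z: "cmod z < 1" for z
  proof -
    have Mz: "cmod (M z) < 1" by (rule M1[OF z])
    have \<psi>z: "cmod (\<psi> t (M z)) < 1" by (rule continuous_conformal_semigroupD(3)[OF S\<psi> t Mz])
    have "(M has_field_derivative deriv M z) (at z)"
      using holomorphic_derivI[OF hol(1)] z by simp
    moreover have "(\<psi> t has_field_derivative deriv (\<psi> t) (M z)) (at (M z))"
      using holomorphic_derivI[OF continuous_conformal_semigroupD(1)[OF S\<psi> t]] Mz by simp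
    moreover have "(N has_field_derivative deriv N (\<psi> t (M z))) (at (\<psi> t (M z)))"
      using holomorphic_derivI[OF hol(2)] \<psi>z by simp
    ultimately have "((\<lambda>z. N (\<psi> t (M z))) has_field_derivative deriv N (\<psi> t (M z)) * (deriv (\<psi> t) (M z) * deriv M z)) (at z)"
      by (intro DERIV_chain2)
    then have "(\<phi> t has_field_derivative deriv N (\<psi> t (M z)) * (deriv (\<psi> t) (M z) * deriv M z)) (at z)"
      by (rule has_field_derivative_transform_within_open[where S = "ball 0 1"])
         (use z NM SD(3)[OF t] in \<open>auto simp: \<psi>_def\<close>)
    then have "deriv (\<phi> t) z = deriv N (\<psi> t (M z)) * (deriv (\<psi> t) (M z) * deriv M z)"
      by (rule DERIV_imp_deriv)
    then have eq: "cmod (deriv (\<phi> t) z) = cmod (deriv N (\<psi> t (M z))) * (cmod (deriv (\<psi> t) (M z)) * cmod (deriv M z))"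
      by (simp add: norm_mult)
    have dM: "m \<le> cmod (deriv M z)"
      unfolding m_def M_def by (rule Moebius_deriv_lower_bound[OF \<tau> z])
    have dN: "m \<le> cmod (deriv N (\<psi> t (M z)))"
      using Moebius_deriv_lower_bound[OF \<tau>' \<psi>z] by (simp add: m_def N_def)
    have "m * (cmod (deriv (\<psi> t) (M z)) * m) \<le> cmod (deriv (\<phi> t) z)"
      unfolding eq using m dM dN by (intro mult_mono) auto
    then have "(m * (cmod (deriv (\<psi> t) (M z)) * m))\<^sup>2 \<le> (cmod (deriv (\<phi> t) z))\<^sup>2"
      using m by (intro power_mono) auto
    then have d: "(cmod (deriv (\<psi> t) (M z)))\<^sup>2 \<le> (cmod (deriv (\<phi> t) z))\<^sup>2 / m ^ 4"
      using m by (simp add: pos_le_divide_eq power_mult_distrib power_numeral_reduce mult_ac)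
    have "m / 2 * (1 - cmod z) \<le> 1 - cmod (M z)"
      using Moebius_boundary_distance[OF \<tau> z] by (simp add: m_def M_def)
    also have "\<dots> \<le> C * cmod (P (M z)) * (cmod (deriv (\<psi> t) (M z)))\<^sup>2" by (rule PC[OF Mz])
    also have "\<dots> \<le> C * cmod (P (M z)) * ((cmod (deriv (\<phi> t) z))\<^sup>2 / m ^ 4)"
      using d P(3) by (intro mult_left_mono) auto
    finally have "1 - cmod z \<le> (2 / m) * (C * cmod (P (M z)) * ((cmod (deriv (\<phi> t) z))\<^sup>2 / m ^ 4))"
      using m by (simp add: field_simps)
    then show ?thesis by (simp add: mult_ac)
  qed
  moreover have "(P \<circ> M) holomorphic_on ball 0 1"
    using M1 by (intro holomorphic_on_compose_gen[OF hol(1) P(1)]) auto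
  moreover have "2 / m * C / m ^ 4 > 0" using m P(3) by simp
  moreover have "Re ((P \<circ> M) z) \<ge> 0" if "cmod z < 1" for z using P(2) M1[OF that] by simp
  ultimately show ?thesis unfolding inverse_derivative_majorant_def by blast
qed

section \<open>Integrability of powers of the derivative\<close>

lemma semigroup_inverse_derivative_majorant:
  assumes S: "continuous_conformal_semigroup \<phi>" and t: "t \<ge> 0"
  shows "inverse_derivative_majorant (\<phi> t)"
proof -
  obtain \<tau> where \<tau>: "cmod \<tau> \<le> 1" and J: "\<And>t. t \<ge> 0 \<Longrightarrow> Julia_at \<tau> (\<phi> t)"
    using semigroup_Wolff_point[OF S] by blast
  show ?thesis
  proof (cases "cmod \<tau> = 1")
    case True
    show ?thesis by (rule boundary_inverse_derivative_majorant[OF S True J t])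
  next
    case False
    then have \<tau>1: "cmod \<tau> < 1" using \<tau> by simp
    have "\<phi> s \<tau> = \<tau>" if "s \<ge> 0" for s
      by (rule Julia_at_interior_imp_fixed[OF J[OF that] \<tau>1 continuous_conformal_semigroupD(3)[OF S that \<tau>1]])
    then show ?thesis by (rule interior_inverse_derivative_majorant[OF S \<tau>1 _ t])
  qed
qed

theorem theorem1p1:
  fixes \<phi> :: "real \<Rightarrow> complex \<Rightarrow> complex" and t p :: real
  assumes "continuous_conformal_semigroup \<phi>"
    and "t \<ge> 0"
    and "p \<in> {-2<..<2/3}"
  shows "(\<integral>\<^sup>+ w. ennreal (cmod (deriv (\<phi> t) w) powr p) \<partial>disk_area) < \<infinity>"
proof -
  note S = assms(1) and t = assms(2)
  note SD = continuous_conformal_semigroupD[OF S]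
  have dnz: "deriv (\<phi> t) z \<noteq> 0" if "cmod z < 1" for z
    using holomorphic_injective_imp_regular[OF SD(1)[OF t] _ SD(2)[OF t], of z] that by simp
  have ex: "\<exists>P C s. P holomorphic_on ball 0 1 \<and> (\<forall>z. cmod z < 1 \<longrightarrow> Re (P z) \<ge> 0) \<and> 0 \<le> s \<and> s < 1 \<and> 0 \<le> C \<and>
     (\<forall>z. cmod z < 1 \<longrightarrow> cmod (deriv (\<phi> t) z) powr p \<le> C * (cmod (P z) powr s * (1 - cmod z) powr (- s)))"
  proof (cases "p \<ge> 0")
    case True
    have "cmod (deriv (\<phi> t) z) powr p \<le> 2 powr p * (cmod 1 powr p * (1 - cmod z) powr (- p))" if z: "cmod z < 1" for z
    proof -
      have "cmod ((deriv ^^ 1) (\<phi> t) z) \<le> fact 1 / ((1 - cmod z) / 2) ^ 1"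
        by (rule disk_self_map_higher_deriv_le[OF SD(1)[OF t] SD(3)[OF t] z]) auto
      then have "cmod (deriv (\<phi> t) z) powr p \<le> (2 / (1 - cmod z)) powr p"
        using True by (intro powr_mono2) auto
      also have "\<dots> = 2 powr p * (1 - cmod z) powr (- p)"
        using z by (simp add: powr_divide powr_minus_divide)
      finally show ?thesis by simp
    qed
    then show ?thesis
      using True assms(3) by (intro exI[of _ "\<lambda>z. 1"] exI[of _ "2 powr p"] exI[of _ p]) auto
  next
    case False
    obtain P C where P: "P holomorphic_on ball 0 1" "\<And>z. cmod z < 1 \<Longrightarrow> Re (P z) \<ge> 0" "C > 0"
      and PC: "\<And>z. cmod z < 1 \<Longrightarrow> 1 - cmod z \<le> C * cmod (P z) * (cmod (deriv (\<phi> t) z))\<^sup>2"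
      using semigroup_inverse_derivative_majorant[OF S t] unfolding inverse_derivative_majorant_def by blast
    define s where "s = - p / 2"
    have s: "0 < s" "s < 1" using False assms(3) by (auto simp: s_def)
    have "cmod (deriv (\<phi> t) z) powr p \<le> C powr s * (cmod (P z) powr s * (1 - cmod z) powr (- s))" if z: "cmod z < 1" for z
    proof -
      define D where "D = cmod (deriv (\<phi> t) z)"
      have D: "D > 0" using dnz[OF z] by (simp add: D_def)
      have CP: "C * cmod (P z) > 0"
      proof (rule ccontr)
        assume "\<not> C * cmod (P z) > 0"
        then have "C * cmod (P z) * D\<^sup>2 \<le> 0" by (simp add: mult_nonpos_nonneg)
        then show False using PC[OF z] z by (simp add: D_def)
      qed
      have "(1 - cmod z) / (C * cmod (P z)) \<le> D\<^sup>2"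
        using PC[OF z] CP by (simp add: D_def pos_divide_le_eq mult_ac)
      then have "(D\<^sup>2) powr (- s) \<le> ((1 - cmod z) / (C * cmod (P z))) powr (- s)"
        using z CP s by (intro powr_mono2') auto
      moreover have "(D\<^sup>2) powr (- s) = D powr p"
        using D by (simp add: powr_powr s_def flip: powr_numeral)
      moreover have "((1 - cmod z) / (C * cmod (P z))) powr (- s) = C powr s * (cmod (P z) powr s * (1 - cmod z) powr (- s))"
        using z P(3) CP by (simp add: powr_divide powr_mult powr_minus field_simps)
      ultimately show ?thesis by (simp add: D_def)
    qed
    then show ?thesis using P s by (intro exI[of _ P] exI[of _ "C powr s"] exI[of _ s]) auto
  qed
  then obtain P C s where P: "P holomorphic_on ball 0 1" "\<And>z. z \<in> ball 0 1 \<Longrightarrow> Re (P z) \<ge> 0"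
    and s: "0 \<le> s" "s < 1" and C: "0 \<le> C"
    and le: "\<And>z. cmod z < 1 \<Longrightarrow> cmod (deriv (\<phi> t) z) powr p \<le> C * (cmod (P z) powr s * (1 - cmod z) powr (- s))"
    by (metis mem_ball_0)
  have borel_eq: "borel_measurable (restrict_space lborel A) = borel_measurable (restrict_space borel A)" for A :: "complex set"
    by (intro measurable_cong_sets sets_restrict_space_cong) auto
  have cont: "continuous_on (ball 0 1) (\<lambda>w. cmod (deriv (\<phi> t) w) powr p)"
    using dnz by (intro continuous_intros holomorphic_on_imp_continuous_on holomorphic_deriv SD(1) t) auto
  then have meas: "(\<lambda>w. cmod (deriv (\<phi> t) w) powr p) \<in> borel_measurable (restrict_space lborel (ball 0 1))"
    unfolding borel_eq by (rule borel_measurable_continuous_on_restrict)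
  have meas2: "(\<lambda>w. cmod (P w) powr s * (1 - cmod w) powr (- s)) \<in> borel_measurable (restrict_space lborel (ball 0 1))"
  proof -
    have [measurable]: "P \<in> borel_measurable (restrict_space lborel (ball 0 1))"
      unfolding borel_eq by (intro borel_measurable_continuous_on_restrict holomorphic_on_imp_continuous_on P)
    have [measurable]: "(\<lambda>w. w) \<in> borel_measurable (restrict_space lborel (ball (0::complex) 1))"
      unfolding borel_eq by (intro borel_measurable_continuous_on_restrict continuous_intros)
    show ?thesis by measurable
  qed
  have "(\<integral>\<^sup>+ w. ennreal (cmod (deriv (\<phi> t) w) powr p) \<partial>disk_area) =
     ennreal (1 / pi) * (\<integral>\<^sup>+ w. ennreal (cmod (deriv (\<phi> t) w) powr p) \<partial>restrict_space lborel (ball 0 1))"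
    unfolding disk_area_def using meas by (intro nn_integral_scale_measure) simp
  also have "(\<integral>\<^sup>+ w. ennreal (cmod (deriv (\<phi> t) w) powr p) \<partial>restrict_space lborel (ball 0 1)) \<le>
     (\<integral>\<^sup>+ w. ennreal C * ennreal (cmod (P w) powr s * (1 - cmod w) powr (- s)) \<partial>restrict_space lborel (ball 0 1))"
    using le C by (intro nn_integral_mono) (auto simp: space_restrict_space ennreal_mult'[symmetric] intro!: ennreal_leI)
  also have "\<dots> = ennreal C * (\<integral>\<^sup>+ w. ennreal (cmod (P w) powr s * (1 - cmod w) powr (- s)) \<partial>restrict_space lborel (ball 0 1))"
    using meas2 by (intro nn_integral_cmult) simp
  also have "(\<integral>\<^sup>+ w. ennreal (cmod (P w) powr s * (1 - cmod w) powr (- s)) \<partial>restrict_space lborel (ball 0 1)) =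
     (\<integral>\<^sup>+ w. ennreal (cmod (P w) powr s * (1 - cmod w) powr (- s)) * indicator (ball 0 1) w \<partial>lborel)"
    by (subst nn_integral_restrict_space) auto
  finally have "(\<integral>\<^sup>+ w. ennreal (cmod (deriv (\<phi> t) w) powr p) \<partial>disk_area) \<le> ennreal (1 / pi) *
     (ennreal C * (\<integral>\<^sup>+ w. ennreal (cmod (P w) powr s * (1 - cmod w) powr (- s)) * indicator (ball 0 1) w \<partial>lborel))"
    by (simp add: mult_left_mono)
  also have "\<dots> < \<infinity>"
    using nn_integral_disk_weighted_power[OF P s] by (simp add: ennreal_mult_less_top)
  finally show ?thesis .
qed

end
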